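(* Let $1\le q\le\infty$, let $T:(X_0,X_1)\to(Y_0,Y_1)$ be a bounded linear operator between Banach couples, and let $I\subset(0,1)$ be an interval of invertibility of $T$ with respect to the family $\{(\,\cdot\,)_{\theta,q}\}_{\theta\in(0,1)}$ of real interpolation functors. Then for any $\theta_0,\theta_1\in I$ the inverse operators $T_{\theta_0}^{-1}:(Y_0,Y_1)_{\theta_0,q}\to(X_0,X_1)_{\theta_0,q}$ and $T_{\theta_1}^{-1}:(Y_0,Y_1)_{\theta_1,q}\to(X_0,X_1)_{\theta_1,q}$ agree on $(Y_0,Y_1)_{\theta_0,q}\cap(Y_0,Y_1)_{\theta_1,q}$.
   Context: $\vec A_{\theta,q}=(A_0,A_1)_{\theta,q}$ is the real interpolation space of $a\in A_0+A_1$ with $\|a\|_{\theta,q}=\big(\int_0^\infty(t^{-\theta}K(t,a;\vec A))^q\,dt/t\big)^{1/q}<\infty$ (for $q=\infty$: $\sup_{t>0}t^{-\theta}K(t,a;\vec A)$), $K(t,a;\vec A)=\inf\{\|a_0\|_{A_0}+t\|a_1\|_{A_1}:a=a_0+a_1\}$. $T_\theta$ is the restriction $T:(X_0,X_1)_{\theta,q}\to(Y_0,Y_1)_{\theta,q}$. The set of $\theta\in(0,1)$ for which $T_\theta$ is invertible is open; an interval of invertibility is an open interval on which $T_\theta$ is invertible for all $\theta$ (a connected component of that set). *)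

theory Defs
  imports "HOL-Analysis.Analysis"
begin

definition norm_on :: "'a::real_vector set \<Rightarrow> ('a \<Rightarrow> real) \<Rightarrow> bool" where
  "norm_on A n \<longleftrightarrow> (\<forall>x\<in>A. 0 \<le> n x) \<and> (\<forall>x\<in>A. n x = 0 \<longleftrightarrow> x = 0) \<and>
     (\<forall>x\<in>A. \<forall>y\<in>A. n (x + y) \<le> n x + n y) \<and> (\<forall>c. \<forall>x\<in>A. n (c *\<^sub>R x) = \<bar>c\<bar> * n x)"

definition banach_on :: "'a::real_vector set \<Rightarrow> ('a \<Rightarrow> real) \<Rightarrow> bool" where
  "banach_on A n \<longleftrightarrow> subspace A \<and> norm_on A n \<and>
     (\<forall>f. (\<forall>k. f k \<in> A) \<and> (\<forall>e>0. \<exists>N. \<forall>m\<ge>N. \<forall>k\<ge>N. n (f m - f k) < e)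
          \<longrightarrow> (\<exists>x\<in>A. (\<lambda>k. n (f k - x)) \<longlonglongrightarrow> 0))"

definition sum_space :: "'a::real_vector set \<Rightarrow> 'a set \<Rightarrow> 'a set" where
  "sum_space A0 A1 = {a0 + a1 | a0 a1. a0 \<in> A0 \<and> a1 \<in> A1}"

definition Kfun :: "'a::real_vector set \<Rightarrow> ('a \<Rightarrow> real) \<Rightarrow> 'a set \<Rightarrow> ('a \<Rightarrow> real) \<Rightarrow> real \<Rightarrow> 'a \<Rightarrow> real" where
  "Kfun A0 n0 A1 n1 t a = Inf {n0 a0 + t * n1 a1 | a0 a1. a0 \<in> A0 \<and> a1 \<in> A1 \<and> a = a0 + a1}"

text \<open>Banach couple: two Banach spaces inside a common vector space, compatible
  (equivalently continuously embedded in a common Hausdorff TVS), i.e. K(1,.) is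
  definite on A0 + A1.\<close>
definition banach_couple :: "'a::real_vector set \<Rightarrow> ('a \<Rightarrow> real) \<Rightarrow> 'a set \<Rightarrow> ('a \<Rightarrow> real) \<Rightarrow> bool" where
  "banach_couple A0 n0 A1 n1 \<longleftrightarrow> banach_on A0 n0 \<and> banach_on A1 n1 \<and>
     (\<forall>a\<in>sum_space A0 A1. Kfun A0 n0 A1 n1 1 a = 0 \<longrightarrow> a = 0)"

definition interp_raw :: "'a::real_vector set \<Rightarrow> ('a \<Rightarrow> real) \<Rightarrow> 'a set \<Rightarrow> ('a \<Rightarrow> real) \<Rightarrow> real \<Rightarrow> ennreal \<Rightarrow> 'a \<Rightarrow> ennreal" where
  "interp_raw A0 n0 A1 n1 \<theta> q a =
     (if q = \<infinity> then (SUP t\<in>{0<..}. ennreal (t powr (-\<theta>) * Kfun A0 n0 A1 n1 t a))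
      else (\<integral>\<^sup>+ t. indicator {0<..} t *
              ennreal ((t powr (-\<theta>) * Kfun A0 n0 A1 n1 t a) powr (enn2real q) / t) \<partial>lborel))"

definition interp_space :: "'a::real_vector set \<Rightarrow> ('a \<Rightarrow> real) \<Rightarrow> 'a set \<Rightarrow> ('a \<Rightarrow> real) \<Rightarrow> real \<Rightarrow> ennreal \<Rightarrow> 'a set" where
  "interp_space A0 n0 A1 n1 \<theta> q = {a \<in> sum_space A0 A1. interp_raw A0 n0 A1 n1 \<theta> q a < \<infinity>}"

definition interp_norm :: "'a::real_vector set \<Rightarrow> ('a \<Rightarrow> real) \<Rightarrow> 'a set \<Rightarrow> ('a \<Rightarrow> real) \<Rightarrow> real \<Rightarrow> ennreal \<Rightarrow> 'a \<Rightarrow> real" where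
  "interp_norm A0 n0 A1 n1 \<theta> q a =
     (if q = \<infinity> then enn2real (interp_raw A0 n0 A1 n1 \<theta> q a)
      else enn2real (interp_raw A0 n0 A1 n1 \<theta> q a) powr (1 / enn2real q))"

definition bounded_op :: "('a \<Rightarrow> 'b) \<Rightarrow> 'a set \<Rightarrow> ('a \<Rightarrow> real) \<Rightarrow> 'b set \<Rightarrow> ('b \<Rightarrow> real) \<Rightarrow> bool" where
  "bounded_op T A nA B nB \<longleftrightarrow> (\<forall>x\<in>A. T x \<in> B) \<and> (\<exists>C. \<forall>x\<in>A. nB (T x) \<le> C * nA x)"

definition couple_op :: "('a::real_vector \<Rightarrow> 'b::real_vector) \<Rightarrow> 'a set \<Rightarrow> ('a \<Rightarrow> real) \<Rightarrow> 'a set \<Rightarrow> ('a \<Rightarrow> real)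
     \<Rightarrow> 'b set \<Rightarrow> ('b \<Rightarrow> real) \<Rightarrow> 'b set \<Rightarrow> ('b \<Rightarrow> real) \<Rightarrow> bool" where
  "couple_op T X0 m0 X1 m1 Y0 n0 Y1 n1 \<longleftrightarrow>
     (\<forall>x\<in>sum_space X0 X1. \<forall>y\<in>sum_space X0 X1. T (x + y) = T x + T y) \<and>
     (\<forall>c. \<forall>x\<in>sum_space X0 X1. T (c *\<^sub>R x) = c *\<^sub>R T x) \<and>
     bounded_op T X0 m0 Y0 n0 \<and> bounded_op T X1 m1 Y1 n1"

definition invertible_op :: "('a \<Rightarrow> 'b) \<Rightarrow> 'a set \<Rightarrow> ('a \<Rightarrow> real) \<Rightarrow> 'b set \<Rightarrow> ('b \<Rightarrow> real) \<Rightarrow> bool" where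
  "invertible_op T A nA B nB \<longleftrightarrow> bounded_op T A nA B nB \<and> bij_betw T A B \<and>
     bounded_op (the_inv_into A T) B nB A nA"

end

theory Submission
  imports Defs
begin

text \<open>
  By connectedness it suffices to show that if \<open>T\<close> is invertible at \<open>a\<close>, then \<open>T\<close> is injective on
  \<open>X\<^sub>a + X\<^sub>b\<close> for \<open>b\<close> close to \<open>a\<close>. Let \<open>x\<close> be in this sum with \<open>T x = 0\<close>, so that
  \<open>K(2\<^sup>n, x) \<le> M 2\<^bsup>na + \<epsilon>|n|\<^esup>\<close>. Put \<open>l = 2\<^bsup>-2\<epsilon>\<^esup>\<close>. From near-optimal splittings of \<open>x\<close> one builds an
  element \<open>x'\<close> of \<open>X\<^sub>a\<close> that looks like \<open>l\<^bsup>|n|\<^esup> x\<close> at scale \<open>2\<^sup>n\<close>, for all \<open>n\<close> simultaneously: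
  \<open>K(2\<^sup>n, x' - l\<^bsup>|n|\<^esup> x)\<close> carries a factor \<open>1/l - 1\<close>, which is small with \<open>\<epsilon>\<close>. Since \<open>T x = 0\<close>, we have
  \<open>T x' = T (x' - l\<^bsup>|n|\<^esup> x)\<close> for every \<open>n\<close>, hence \<open>K(2\<^sup>n, T x')\<close> is small relative to \<open>K(2\<^sup>n, x')\<close>
  (after passing to slowly varying majorants). This contradicts the lower bound for \<open>T\<close> on \<open>X\<^sub>a\<close>
  unless \<open>x' = 0\<close>, and then \<open>x = 0\<close>.
\<close>

section \<open>Norms carried by a subspace, and absolutely convergent series\<close>

lemma norm_on_nonneg: "norm_on A n \<Longrightarrow> x \<in> A \<Longrightarrow> 0 \<le> n x"
  and norm_on_eq_0_iff: "norm_on A n \<Longrightarrow> x \<in> A \<Longrightarrow> n x = 0 \<longleftrightarrow> x = 0"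
  and norm_on_add_le: "norm_on A n \<Longrightarrow> x \<in> A \<Longrightarrow> y \<in> A \<Longrightarrow> n (x + y) \<le> n x + n y"
  and norm_on_scaleR: "norm_on A n \<Longrightarrow> x \<in> A \<Longrightarrow> n (c *\<^sub>R x) = \<bar>c\<bar> * n x"
  by (auto simp: norm_on_def)

lemma norm_on_minus: "norm_on A n \<Longrightarrow> x \<in> A \<Longrightarrow> n (- x) = n x"
  using norm_on_scaleR[of A n x "-1"] by simp

lemma norm_on_diff_le:
  assumes "subspace A" "norm_on A n" "x \<in> A" "y \<in> A"
  shows "n (x - y) \<le> n x + n y"
  using norm_on_add_le[OF assms(2,3) subspace_neg[OF assms(1,4)]] norm_on_minus[OF assms(2,4)] by simp

lemma norm_on_sum_le:
  assumes "subspace A" "norm_on A n" "finite S" "\<And>i. i \<in> S \<Longrightarrow> f i \<in> A"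
  shows "n (\<Sum>i\<in>S. f i) \<le> (\<Sum>i\<in>S. n (f i))"
  using assms(3,4)
proof (induction S rule: finite_induct)
  case empty
  then show ?case using assms norm_on_eq_0_iff subspace_0 by fastforce
next
  case (insert i S)
  have "(\<Sum>i\<in>S. f i) \<in> A" using insert assms(1) by (intro subspace_sum) auto
  then show ?case using insert norm_on_add_le[OF assms(2), of "f i" "\<Sum>i\<in>S. f i"] by force
qed

text \<open>Partial sums are Cauchy by comparison with the summable norms. A single limit
  \<open>s\<close> serves all \<open>N\<close> and all majorants \<open>w\<close>, because the
  multiplier construction estimates tails of one series against a different geometric majorant at
  each scale.\<close>

lemma banach_on_series:
  assumes "banach_on A n" "\<And>j. f j \<in> A" "summable (\<lambda>j. n (f j))"
  shows "\<exists>s\<in>A. \<forall>N w. summable w \<longrightarrow> (\<forall>j. n (f (N + j)) \<le> w j) \<longrightarrow> n (s - (\<Sum>j<N. f j)) \<le> suminf w"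
proof -
  have sub: "subspace A" and nrm: "norm_on A n" using assms(1) by (auto simp: banach_on_def)
  define S where "S N = (\<Sum>j<N. f j)" for N
  have SA: "S N \<in> A" for N using assms sub unfolding S_def by (intro subspace_sum) auto
  have diff: "n (S (N + m) - S N) \<le> (\<Sum>j<m. n (f (N + j)))" for N m
  proof -
    have "S (N + m) - S N = (\<Sum>j<m. f (N + j))"
      unfolding S_def by (induction m) (auto simp: algebra_simps)
    then show ?thesis using norm_on_sum_le[OF sub nrm, of "{..<m}" "\<lambda>j. f (N + j)"] assms(2) by simp
  qed
  have tail: "n (S (N + m) - S N) \<le> suminf w"
    if "summable w" "\<And>j. n (f (N + j)) \<le> w j" for N m w
  proof -
    have w0: "w j \<ge> 0" for j using that(2)[of j] norm_on_nonneg[OF nrm assms(2), of "N + j"] by linarith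
    have "(\<Sum>j<m. n (f (N + j))) \<le> (\<Sum>j<m. w j)" by (intro sum_mono that)
    also have "\<dots> \<le> suminf w" using w0 by (intro sum_le_suminf that) auto
    finally show ?thesis using diff[of N m] by linarith
  qed
  have "\<exists>N. \<forall>m\<ge>N. \<forall>k\<ge>N. n (S m - S k) < e" if e: "e > 0" for e
  proof -
    obtain N where N: "\<And>m. m \<ge> N \<Longrightarrow> norm (suminf (\<lambda>j. n (f (j + m)))) < e / 2"
      using suminf_exist_split[OF half_gt_zero[OF e] assms(3)] by auto
    have sm: "summable (\<lambda>j. n (f (N + j)))" using summable_ignore_initial_segment[OF assms(3), of N]
      by (simp add: add.commute)
    have near: "n (S m - S N) < e / 2" if "m \<ge> N" for m
    proof -
      have "n (S (N + (m - N)) - S N) \<le> suminf (\<lambda>j. n (f (N + j)))" by (intro tail sm) auto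
      then show ?thesis using N[of N] that by (simp add: add.commute)
    qed
    have "n (S m - S k) < e" if "m \<ge> N" "k \<ge> N" for m k
    proof -
      have "S m - S k = (S m - S N) - (S k - S N)" by simp
      then have "n (S m - S k) \<le> n (S m - S N) + n (S k - S N)"
        using norm_on_diff_le[OF sub nrm subspace_diff[OF sub SA SA] subspace_diff[OF sub SA SA]] by metis
      then show ?thesis using near[OF that(1)] near[OF that(2)] by linarith
    qed
    then show ?thesis by blast
  qed
  then obtain s where s: "s \<in> A" "(\<lambda>k. n (S k - s)) \<longlonglongrightarrow> 0"
    using assms(1) SA unfolding banach_on_def by blast
  show ?thesis
  proof (intro bexI[OF _ s(1)] allI impI)
    fix N and w :: "nat \<Rightarrow> real" assume w: "summable w" "\<forall>j. n (f (N + j)) \<le> w j"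
    have "n (s - S N) \<le> suminf w + n (S (m + N) - s)" for m
    proof -
      have "s - S N = (S (N + m) - S N) - (S (N + m) - s)" by simp
      then have "n (s - S N) \<le> n (S (N + m) - S N) + n (S (N + m) - s)"
        using norm_on_diff_le[OF sub nrm subspace_diff[OF sub SA SA] subspace_diff[OF sub SA s(1)]] by metis
      then show ?thesis using tail[OF w(1), of N m] w(2) by (simp add: add.commute)
    qed
    moreover have "(\<lambda>m. suminf w + n (S (m + N) - s)) \<longlonglongrightarrow> suminf w + 0"
      by (intro tendsto_add tendsto_const LIMSEQ_ignore_initial_segment s)
    ultimately show "n (s - (\<Sum>j<N. f j)) \<le> suminf w"
      unfolding S_def[symmetric] by (intro LIMSEQ_le_const[where X = "\<lambda>m. suminf w + n (S (m + N) - s)"]) auto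
  qed
qed

subsection \<open>The K-functional\<close>

locale normed_couple =
  fixes A0 A1 :: "'a::real_vector set" and n0 n1 :: "'a \<Rightarrow> real"
  assumes subspace0: "subspace A0" and subspace1: "subspace A1"
    and norm0: "norm_on A0 n0" and norm1: "norm_on A1 n1"
begin

abbreviation K :: "real \<Rightarrow> 'a \<Rightarrow> real" where "K \<equiv> Kfun A0 n0 A1 n1"

lemma subspace_sum_space: "subspace (sum_space A0 A1)"
  using subspace_sums[OF subspace0 subspace1] unfolding sum_space_def by (metis (lifting))

lemma sum_spaceI: "a0 \<in> A0 \<Longrightarrow> a1 \<in> A1 \<Longrightarrow> a0 + a1 \<in> sum_space A0 A1"
  by (auto simp: sum_space_def)

lemma K_le:
  assumes "t \<ge> 0" "a0 \<in> A0" "a1 \<in> A1"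
  shows "K t (a0 + a1) \<le> n0 a0 + t * n1 a1"
  unfolding Kfun_def using assms norm_on_nonneg[OF norm0] norm_on_nonneg[OF norm1]
  by (intro cInf_lower bdd_belowI[of _ 0]) auto

lemma K_greatest:
  assumes "x \<in> sum_space A0 A1"
    "\<And>a0 a1. a0 \<in> A0 \<Longrightarrow> a1 \<in> A1 \<Longrightarrow> x = a0 + a1 \<Longrightarrow> c \<le> n0 a0 + t * n1 a1"
  shows "c \<le> K t x"
  unfolding Kfun_def using assms by (intro cInf_greatest) (auto simp: sum_space_def)

lemma K_nonneg: "t \<ge> 0 \<Longrightarrow> x \<in> sum_space A0 A1 \<Longrightarrow> 0 \<le> K t x"
  by (intro K_greatest)
    (auto intro!: add_nonneg_nonneg mult_nonneg_nonneg norm_on_nonneg[OF norm0] norm_on_nonneg[OF norm1])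

lemma K_decompose:
  assumes "x \<in> sum_space A0 A1" "K t x < c"
  obtains a0 a1 where "a0 \<in> A0" "a1 \<in> A1" "x = a0 + a1" "n0 a0 + t * n1 a1 < c"
  using K_greatest[OF assms(1), of c t] assms(2) by (meson not_le)

lemma K_add_le:
  assumes "t \<ge> 0" "x \<in> sum_space A0 A1" "y \<in> sum_space A0 A1"
  shows "K t (x + y) \<le> K t x + K t y"
proof (rule field_le_epsilon)
  fix e :: real assume "e > 0"
  obtain a0 a1 where a: "a0 \<in> A0" "a1 \<in> A1" "x = a0 + a1" "n0 a0 + t * n1 a1 < K t x + e/2"
    using K_decompose[OF assms(2), of t "K t x + e/2"] \<open>e > 0\<close> by auto
  obtain b0 b1 where b: "b0 \<in> A0" "b1 \<in> A1" "y = b0 + b1" "n0 b0 + t * n1 b1 < K t y + e/2"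
    using K_decompose[OF assms(3), of t "K t y + e/2"] \<open>e > 0\<close> by auto
  have "K t ((a0 + b0) + (a1 + b1)) \<le> n0 (a0 + b0) + t * n1 (a1 + b1)"
    using a b assms(1) subspace_add[OF subspace0] subspace_add[OF subspace1] by (intro K_le) auto
  also have "\<dots> \<le> (n0 a0 + n0 b0) + t * (n1 a1 + n1 b1)"
    using a b assms(1) by (intro add_mono mult_left_mono norm_on_add_le[OF norm0] norm_on_add_le[OF norm1])
  finally show "K t (x + y) \<le> K t x + K t y + e" using a b by (simp add: algebra_simps)
qed

lemma K_scaleR_le:
  assumes "t \<ge> 0" "x \<in> sum_space A0 A1"
  shows "K t (c *\<^sub>R x) \<le> \<bar>c\<bar> * K t x"
proof (cases "c = 0")
  case True
  then show ?thesis using K_le[OF assms(1) subspace_0[OF subspace0] subspace_0[OF subspace1]]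
      norm_on_eq_0_iff[OF norm0 subspace_0[OF subspace0]] norm_on_eq_0_iff[OF norm1 subspace_0[OF subspace1]]
    by simp
next
  case False
  have "K t (c *\<^sub>R x) / \<bar>c\<bar> \<le> K t x"
  proof (rule K_greatest[OF assms(2)])
    fix a0 a1 assume a: "a0 \<in> A0" "a1 \<in> A1" "x = a0 + a1"
    have "K t (c *\<^sub>R a0 + c *\<^sub>R a1) \<le> n0 (c *\<^sub>R a0) + t * n1 (c *\<^sub>R a1)"
      using a assms(1) subspace0 subspace1 by (intro K_le subspace_scale) auto
    also have "\<dots> = \<bar>c\<bar> * (n0 a0 + t * n1 a1)"
      using a norm_on_scaleR[OF norm0] norm_on_scaleR[OF norm1] by (simp add: algebra_simps)
    finally show "K t (c *\<^sub>R x) / \<bar>c\<bar> \<le> n0 a0 + t * n1 a1"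
      using False a by (simp add: scaleR_add_right field_simps)
  qed
  then show ?thesis using False by (simp add: field_simps)
qed

lemma K_scaleR:
  assumes "t \<ge> 0" "x \<in> sum_space A0 A1"
  shows "K t (c *\<^sub>R x) = \<bar>c\<bar> * K t x"
proof (cases "c = 0")
  case True
  then show ?thesis using K_scaleR_le[OF assms, of 0] K_nonneg[OF assms(1) subspace_0[OF subspace_sum_space]]
    by simp
next
  case False
  have "K t x \<le> \<bar>inverse c\<bar> * K t (c *\<^sub>R x)"
    using K_scaleR_le[OF assms(1) subspace_scale[OF subspace_sum_space assms(2)], of "inverse c" c] False by simp
  then have "\<bar>c\<bar> * K t x \<le> K t (c *\<^sub>R x)" using False by (simp add: field_simps)
  then show ?thesis using K_scaleR_le[OF assms, of c] by simp
qed

lemma K_diff_le: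
  assumes "t \<ge> 0" "x \<in> sum_space A0 A1" "y \<in> sum_space A0 A1"
  shows "K t (x - y) \<le> K t x + K t y"
  using K_add_le[OF assms(1,2) subspace_neg[OF subspace_sum_space assms(3)]]
    K_scaleR[OF assms(1,3), of "-1"] by simp

lemma K_mono:
  assumes "0 \<le> s" "s \<le> t" "x \<in> sum_space A0 A1"
  shows "K s x \<le> K t x"
proof (rule K_greatest[OF assms(3)])
  fix a0 a1 assume a: "a0 \<in> A0" "a1 \<in> A1" "x = a0 + a1"
  have "s * n1 a1 \<le> t * n1 a1" using a assms by (intro mult_right_mono norm_on_nonneg[OF norm1])
  then show "K s x \<le> n0 a0 + t * n1 a1" using K_le[of s a0 a1] a assms by simp
qed

text \<open>Enlarging \<open>s\<close> by the factor \<open>c\<close> multiplies the second term of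
  every splitting by \<open>c\<close>, and the first term only grows when multiplied by
  \<open>c\<close>. Together with \<open>K_mono\<close> this keeps \<open>K\<close> within a factor
  2 on each dyadic interval.\<close>

lemma K_scale_le:
  assumes "0 < s" "1 \<le> c" "x \<in> sum_space A0 A1"
  shows "K (c * s) x \<le> c * K s x"
proof -
  have "K (c * s) x / c \<le> K s x"
  proof (rule K_greatest[OF assms(3)])
    fix a0 a1 assume a: "a0 \<in> A0" "a1 \<in> A1" "x = a0 + a1"
    have "n0 a0 \<le> c * n0 a0" using assms norm_on_nonneg[OF norm0 a(1)] by (simp add: mult_le_cancel_right1)
    then have "K (c * s) x \<le> c * (n0 a0 + s * n1 a1)"
      using K_le[of "c * s" a0 a1] a assms by (simp add: algebra_simps)
    then show "K (c * s) x / c \<le> n0 a0 + s * n1 a1" using assms by (simp add: field_simps)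
  qed
  then show ?thesis using assms by (simp add: field_simps)
qed

end

subsection \<open>Dyadic discretisation\<close>

lemma dyadic_interval_iff:
  fixes t :: real
  assumes "t > 0"
  shows "t \<in> {2 powr real_of_int n..<2 powr (real_of_int n + 1)} \<longleftrightarrow> n = \<lfloor>log 2 t\<rfloor>"
proof -
  have "2 powr real_of_int n \<le> t \<longleftrightarrow> real_of_int n \<le> log 2 t"
    using assms by (simp add: le_log_iff)
  moreover have "t < 2 powr (real_of_int n + 1) \<longleftrightarrow> log 2 t < real_of_int n + 1"
    using assms by (simp add: log_less_iff)
  ultimately show ?thesis by (auto simp: floor_eq_iff eq_commute[of n])
qed

text \<open>The intervals partition the positive half-line, so exactly one summand survives. Writing
  the sum as an integral over counting measure lets Tonelli reduce the integral of a step function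
  to interval lengths in \<open>nn_integral_dyadic\<close>.\<close>

lemma nn_integral_count_dyadic:
  fixes t :: real and c :: "int \<Rightarrow> ennreal"
  shows "(\<integral>\<^sup>+n. c n * indicator {2 powr real_of_int n..<2 powr (real_of_int n + 1)} t \<partial>count_space UNIV)
    = indicator {0<..} t * c \<lfloor>log 2 t\<rfloor>"
proof (cases "t > 0")
  case True
  have "(\<integral>\<^sup>+n. c n * indicator {2 powr real_of_int n..<2 powr (real_of_int n + 1)} t \<partial>count_space UNIV)
     = (\<integral>\<^sup>+n. c n * indicator {\<lfloor>log 2 t\<rfloor>} n \<partial>count_space UNIV)"
    using dyadic_interval_iff[OF True] by (intro nn_integral_cong) (auto simp: indicator_def)
  then show ?thesis using True by (simp add: nn_integral_indicator_singleton)
next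
  case False
  then have "t \<notin> {2 powr real_of_int n..<2 powr (real_of_int n + 1)}" for n
    by (metis atLeastLessThan_iff less_le_trans powr_gt_zero zero_neq_numeral)
  then show ?thesis using False by simp
qed

lemma nn_integral_dyadic:
  fixes c :: "int \<Rightarrow> ennreal"
  shows "(\<integral>\<^sup>+t. indicator {0<..} t * c \<lfloor>log 2 t\<rfloor> \<partial>lborel)
    = (\<integral>\<^sup>+n. c n * ennreal (2 powr real_of_int n) \<partial>count_space UNIV)"
proof -
  have "(\<integral>\<^sup>+t. indicator {0<..} t * c \<lfloor>log 2 t\<rfloor> \<partial>lborel)
    = (\<integral>\<^sup>+n. \<integral>\<^sup>+t. c n * indicator {2 powr real_of_int n..<2 powr (real_of_int n + 1)} t \<partial>lborel \<partial>count_space UNIV)"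
    by (subst nn_integral_count_dyadic[symmetric], subst nn_integral_count_space_nn_integral) auto
  also have "\<dots> = (\<integral>\<^sup>+n. c n * ennreal (2 powr real_of_int n) \<partial>count_space UNIV)"
    by (intro nn_integral_cong) (simp add: nn_integral_cmult_indicator powr_add)
  finally show ?thesis .
qed

lemma nn_integral_geometric_int:
  fixes s :: real
  assumes "0 \<le> s" "s < 1"
  shows "(\<integral>\<^sup>+n. ennreal (s ^ nat \<bar>n\<bar>) \<partial>count_space (UNIV :: int set)) \<le> ennreal (2 / (1 - s))"
proof -
  have geo: "(\<integral>\<^sup>+n. ennreal (s ^ n) \<partial>count_space (UNIV :: nat set)) = ennreal (1 / (1 - s))"
    using assms summable_geometric[of s] suminf_geometric[of s]
    by (subst nn_integral_count_space_nat) (simp add: suminf_ennreal2)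
  \<comment> \<open>Both half-lines contain 0, which is therefore counted twice; hence an inequality
    with the round constant \<open>2 / (1 - s)\<close>.\<close>
  have "(\<integral>\<^sup>+n. ennreal (s ^ nat \<bar>n\<bar>) \<partial>count_space (UNIV :: int set))
     \<le> (\<integral>\<^sup>+n. ennreal (s ^ nat \<bar>n\<bar>) * indicator {0..} n + ennreal (s ^ nat \<bar>n\<bar>) * indicator {..0} n \<partial>count_space (UNIV :: int set))"
    by (intro nn_integral_mono) (auto simp: indicator_def)
  also have "\<dots> = (\<integral>\<^sup>+n. ennreal (s ^ nat \<bar>n\<bar>) \<partial>count_space {0::int..}) + (\<integral>\<^sup>+n. ennreal (s ^ nat \<bar>n\<bar>) \<partial>count_space {..0::int})"
    by (simp add: nn_integral_add nn_integral_count_space_indicator)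
  also have "(\<integral>\<^sup>+n. ennreal (s ^ nat \<bar>n\<bar>) \<partial>count_space {0::int..}) = (\<integral>\<^sup>+n. ennreal (s ^ n) \<partial>count_space (UNIV :: nat set))"
  proof -
    have "bij_betw int UNIV {0..}" by (rule bij_betwI[where g = nat]) auto
    from nn_integral_bij_count_space[OF this, symmetric] show ?thesis by simp
  qed
  also have "(\<integral>\<^sup>+n. ennreal (s ^ nat \<bar>n\<bar>) \<partial>count_space {..0::int}) = (\<integral>\<^sup>+n. ennreal (s ^ n) \<partial>count_space (UNIV :: nat set))"
  proof -
    have "bij_betw (\<lambda>n. - int n) UNIV {..0}" by (rule bij_betwI[where g = "\<lambda>n. nat (- n)"]) auto
    from nn_integral_bij_count_space[OF this, symmetric] show ?thesis by simp
  qed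
  finally show ?thesis using assms by (simp add: geo flip: ennreal_plus)
qed

context normed_couple
begin

text \<open>For \<open>a\<close> in (0,1) the \<open>lq\<close> norm of this sequence is equivalent
  to the interpolation norm of exponent \<open>a\<close>, so the argument becomes one about the
  scales t = 2^n.\<close>

definition dyadic_K :: "real \<Rightarrow> 'a \<Rightarrow> int \<Rightarrow> real" where
  "dyadic_K a x n = 2 powr (- a * real_of_int n) * K (2 powr real_of_int n) x"

lemma dyadic_K_nonneg: "x \<in> sum_space A0 A1 \<Longrightarrow> 0 \<le> dyadic_K a x n"
  by (simp add: dyadic_K_def K_nonneg)

text \<open>Within a dyadic interval \<open>K\<close> grows by at most a factor 2, and
  \<open>t powr (- a)\<close> shrinks at most by the factor \<open>2 powr (- a)\<close>, which is at
  least 1/2 because \<open>a < 1\<close>. The constants are thus independent of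
  \<open>a\<close>.\<close>

lemma
  assumes "0 < a" "a < 1" "x \<in> sum_space A0 A1" "0 < t"
  shows weighted_K_le_dyadic_K: "t powr (- a) * K t x \<le> 2 * dyadic_K a x \<lfloor>log 2 t\<rfloor>"
    and dyadic_K_le_weighted_K: "dyadic_K a x \<lfloor>log 2 t\<rfloor> \<le> 2 * (t powr (- a) * K t x)"
proof -
  define n where "n = \<lfloor>log 2 t\<rfloor>"
  define s :: real where "s = 2 powr real_of_int n"
  have s0: "s > 0" by (simp add: s_def)
  have t: "s \<le> t" "t < 2 * s"
    using dyadic_interval_iff[OF assms(4), of n] by (auto simp: n_def s_def powr_add)
  have sa: "2 powr (- a * real_of_int n) = s powr (- a)" by (simp add: s_def powr_powr mult.commute)
  have K0: "0 \<le> K s x" "0 \<le> K t x" using s0 assms by (auto intro!: K_nonneg)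
  have "K t x \<le> K (2 * s) x" using t s0 assms by (intro K_mono) auto
  also have "\<dots> \<le> 2 * K s x" using s0 assms by (intro K_scale_le) auto
  finally have K2: "K t x \<le> 2 * K s x" .
  have pw: "t powr (- a) \<le> s powr (- a)" using t s0 assms by (intro powr_mono2') auto
  have "t powr (- a) * K t x \<le> s powr (- a) * (2 * K s x)" using pw K2 K0 by (intro mult_mono) auto
  then show "t powr (- a) * K t x \<le> 2 * dyadic_K a x \<lfloor>log 2 t\<rfloor>"
    unfolding dyadic_K_def n_def[symmetric] sa s_def[symmetric] by simp
  have "(2 * s) powr (- a) \<le> t powr (- a)" using t s0 assms by (intro powr_mono2') auto
  moreover have "1/2 \<le> (2::real) powr (- a)"
  proof -
    have "(2::real) powr (- 1) \<le> 2 powr (- a)" using assms by (intro powr_mono) auto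
    then show ?thesis by (simp add: powr_minus)
  qed
  then have "1/2 * s powr (- a) \<le> 2 powr (- a) * s powr (- a)" by (intro mult_right_mono) auto
  moreover have "(2 * s) powr (- a) = 2 powr (- a) * s powr (- a)" using s0 by (simp add: powr_mult)
  ultimately have "s powr (- a) / 2 \<le> t powr (- a)" by linarith
  moreover have "K s x \<le> K t x" using t s0 assms by (intro K_mono) auto
  ultimately have "s powr (- a) / 2 * K s x \<le> t powr (- a) * K t x" using K0 by (intro mult_mono) auto
  then show "dyadic_K a x \<lfloor>log 2 t\<rfloor> \<le> 2 * (t powr (- a) * K t x)"
    unfolding dyadic_K_def n_def[symmetric] sa s_def[symmetric] by simp
qed

text \<open>A step function on the dyadic intervals dominates the integrand. Replacing 1/t by
  \<open>2 powr (- real_of_int n)\<close> cancels the interval length 2^n, reflecting the scale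
  invariance of dt/t.\<close>

lemma interp_raw_le_dyadic_K:
  assumes "0 < a" "a < 1" "x \<in> sum_space A0 A1" "1 \<le> q" "q \<noteq> \<infinity>"
  shows "interp_raw A0 n0 A1 n1 a q x
    \<le> (\<integral>\<^sup>+n. ennreal ((2 * dyadic_K a x n) powr enn2real q) \<partial>count_space UNIV)"
proof -
  define p where "p = enn2real q"
  have p: "p \<ge> 0" by (simp add: p_def)
  define c where "c n = ennreal ((2 * dyadic_K a x n) powr p * 2 powr (- real_of_int n))" for n
  have "interp_raw A0 n0 A1 n1 a q x =
     (\<integral>\<^sup>+ t. indicator {0<..} t * ennreal ((t powr (-a) * K t x) powr p / t) \<partial>lborel)"
    using assms by (simp add: interp_raw_def p_def)
  also have "\<dots> \<le> (\<integral>\<^sup>+ t. indicator {0<..} t * c \<lfloor>log 2 t\<rfloor> \<partial>lborel)"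
  proof (rule nn_integral_mono)
    fix t :: real
    show "indicator {0<..} t * ennreal ((t powr (-a) * K t x) powr p / t) \<le> indicator {0<..} t * c \<lfloor>log 2 t\<rfloor>"
    proof (cases "t > 0")
      case True
      have "2 powr real_of_int \<lfloor>log 2 t\<rfloor> \<le> t" using dyadic_interval_iff[OF True] by auto
      then have "1 / t \<le> 2 powr (- real_of_int \<lfloor>log 2 t\<rfloor>)"
        using True by (simp add: powr_minus field_simps)
      moreover have "(t powr (-a) * K t x) powr p \<le> (2 * dyadic_K a x \<lfloor>log 2 t\<rfloor>) powr p"
        using weighted_K_le_dyadic_K[OF assms(1-3) True] K_nonneg[of t x] assms True p by (intro powr_mono2) auto
      ultimately have "(t powr (-a) * K t x) powr p * (1 / t) \<le> (2 * dyadic_K a x \<lfloor>log 2 t\<rfloor>) powr p * 2 powr (- real_of_int \<lfloor>log 2 t\<rfloor>)"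
        using True by (intro mult_mono) auto
      then show ?thesis using True by (auto simp: c_def intro!: ennreal_leI)
    qed simp
  qed
  also have "\<dots> = (\<integral>\<^sup>+n. c n * ennreal (2 powr real_of_int n) \<partial>count_space UNIV)"
    by (rule nn_integral_dyadic)
  also have "\<dots> = (\<integral>\<^sup>+n. ennreal ((2 * dyadic_K a x n) powr p) \<partial>count_space UNIV)"
    by (intro nn_integral_cong) (simp add: c_def ennreal_mult[symmetric] mult.assoc powr_add[symmetric])
  finally show ?thesis unfolding p_def .
qed

text \<open>The outer 1/2 accounts for the drop of 1/t below its value at the left endpoint of a
  dyadic interval; the inner one comes from \<open>dyadic_K_le_weighted_K\<close>.\<close>

lemma dyadic_K_le_interp_raw:
  assumes "0 < a" "a < 1" "x \<in> sum_space A0 A1" "1 \<le> q" "q \<noteq> \<infinity>"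
  shows "(\<integral>\<^sup>+n. ennreal ((dyadic_K a x n / 2) powr enn2real q / 2) \<partial>count_space UNIV)
    \<le> interp_raw A0 n0 A1 n1 a q x"
proof -
  define p where "p = enn2real q"
  have p: "p \<ge> 0" by (simp add: p_def)
  define c where "c n = ennreal ((dyadic_K a x n / 2) powr p / 2 * 2 powr (- real_of_int n))" for n
  have "(\<integral>\<^sup>+n. ennreal ((dyadic_K a x n / 2) powr p / 2) \<partial>count_space UNIV)
     = (\<integral>\<^sup>+n. c n * ennreal (2 powr real_of_int n) \<partial>count_space UNIV)"
    by (intro nn_integral_cong)
       (simp add: c_def ennreal_mult[symmetric] mult.assoc powr_add[symmetric] del: times_divide_eq_left)
  also have "\<dots> = (\<integral>\<^sup>+ t. indicator {0<..} t * c \<lfloor>log 2 t\<rfloor> \<partial>lborel)"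
    by (rule nn_integral_dyadic[symmetric])
  also have "\<dots> \<le> (\<integral>\<^sup>+ t. indicator {0<..} t * ennreal ((t powr (-a) * K t x) powr p / t) \<partial>lborel)"
  proof (rule nn_integral_mono)
    fix t :: real
    show "indicator {0<..} t * c \<lfloor>log 2 t\<rfloor> \<le> indicator {0<..} t * ennreal ((t powr (-a) * K t x) powr p / t)"
    proof (cases "t > 0")
      case True
      have "t < 2 * 2 powr real_of_int \<lfloor>log 2 t\<rfloor>"
        using dyadic_interval_iff[OF True, of "\<lfloor>log 2 t\<rfloor>"] by (simp add: powr_add)
      then have "1 / 2 * 2 powr (- real_of_int \<lfloor>log 2 t\<rfloor>) \<le> 1 / t"
        using True by (simp add: powr_minus field_simps)
      moreover have "(dyadic_K a x \<lfloor>log 2 t\<rfloor> / 2) powr p \<le> (t powr (-a) * K t x) powr p"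
        using dyadic_K_le_weighted_K[OF assms(1-3) True] dyadic_K_nonneg[OF assms(3)] p by (intro powr_mono2) auto
      ultimately have "(dyadic_K a x \<lfloor>log 2 t\<rfloor> / 2) powr p * (1 / 2 * 2 powr (- real_of_int \<lfloor>log 2 t\<rfloor>))
          \<le> (t powr (-a) * K t x) powr p * (1 / t)"
        using True by (intro mult_mono) auto
      then show ?thesis using True by (auto simp: c_def intro!: ennreal_leI)
    qed simp
  qed
  also have "\<dots> = interp_raw A0 n0 A1 n1 a q x"
    using assms by (simp add: interp_raw_def p_def)
  finally show ?thesis unfolding p_def .
qed

end

subsection \<open>Sequence norms over the integers\<close>

text \<open>Shaped like \<open>interp_raw\<close>: for finite \<open>q\<close> this is the q-th
  power of the norm. Finiteness has to be tested at this level, because \<open>enn2real\<close>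
  sends infinity to 0 and \<open>lq_norm\<close> no longer sees divergence.\<close>

definition lq_raw :: "ennreal \<Rightarrow> (int \<Rightarrow> real) \<Rightarrow> ennreal" where
  "lq_raw q f = (if q = \<infinity> then (SUP n. ennreal (f n))
     else (\<integral>\<^sup>+n. ennreal (f n powr enn2real q) \<partial>count_space UNIV))"

definition lq_norm :: "ennreal \<Rightarrow> (int \<Rightarrow> real) \<Rightarrow> real" where
  "lq_norm q f = (if q = \<infinity> then enn2real (lq_raw q f) else enn2real (lq_raw q f) powr (1 / enn2real q))"

lemma enn2real_ge_1: "1 \<le> q \<Longrightarrow> q \<noteq> \<infinity> \<Longrightarrow> 1 \<le> enn2real q"
  by (metis enn2real_1 enn2real_mono infinity_ennreal_def less_top)

lemma lq_raw_mono:
  assumes "\<And>n. 0 \<le> f n" "\<And>n. f n \<le> g n"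
  shows "lq_raw q f \<le> lq_raw q g"
  using assms by (auto simp: lq_raw_def intro!: nn_integral_mono SUP_mono ennreal_leI powr_mono2)

lemma lq_norm_mono:
  assumes "\<And>n. 0 \<le> f n" "\<And>n. f n \<le> g n" "lq_raw q g < \<infinity>"
  shows "lq_norm q f \<le> lq_norm q g"
  using assms lq_raw_mono[of f g q] by (auto simp: lq_norm_def intro!: enn2real_mono powr_mono2)

lemma lq_raw_cmult:
  assumes "0 \<le> c" "\<And>n. 0 \<le> f n" "1 \<le> q"
  shows "lq_raw q (\<lambda>n. c * f n) = ennreal (if q = \<infinity> then c else c powr enn2real q) * lq_raw q f"
proof (cases "q = \<infinity>")
  case True
  then show ?thesis using assms by (simp add: lq_raw_def ennreal_mult SUP_mult_left_ennreal)
next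
  case False
  then show ?thesis using assms by (simp add: lq_raw_def powr_mult ennreal_mult nn_integral_cmult)
qed

lemma lq_raw_cmult_finite:
  assumes "0 \<le> c" "\<And>n. 0 \<le> f n" "1 \<le> q" "lq_raw q f < \<infinity>"
  shows "lq_raw q (\<lambda>n. c * f n) < \<infinity>"
  using assms by (simp add: lq_raw_cmult ennreal_mult_less_top)

lemma lq_norm_cmult:
  assumes "0 \<le> c" "\<And>n. 0 \<le> f n" "1 \<le> q"
  shows "lq_norm q (\<lambda>n. c * f n) = c * lq_norm q f"
proof (cases "q = \<infinity>")
  case True
  then show ?thesis using assms by (simp add: lq_norm_def lq_raw_cmult enn2real_mult)
next
  case False
  then show ?thesis using assms enn2real_ge_1[OF assms(3) False]
    by (simp add: lq_norm_def lq_raw_cmult enn2real_mult powr_mult powr_powr)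
qed

lemma le_lq_norm:
  assumes "\<And>n. 0 \<le> f n" "1 \<le> q" "lq_raw q f < \<infinity>"
  shows "f n \<le> lq_norm q f"
proof (cases "q = \<infinity>")
  case True
  have "ennreal (f n) \<le> lq_raw q f" using True by (auto simp: lq_raw_def intro: SUP_upper)
  then have "enn2real (ennreal (f n)) \<le> enn2real (lq_raw q f)" using assms by (intro enn2real_mono) auto
  then show ?thesis using assms True by (simp add: lq_norm_def)
next
  case False
  define p where "p = enn2real q"
  have p: "1 \<le> p" using enn2real_ge_1[OF assms(2) False] by (simp add: p_def)
  have "ennreal (f n powr p) = (\<integral>\<^sup>+k. ennreal (f k powr p) * indicator {n} k \<partial>count_space UNIV)"
    by (simp add: nn_integral_indicator_singleton)
  also have "\<dots> \<le> lq_raw q f"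
    using False by (auto simp: lq_raw_def p_def indicator_def intro!: nn_integral_mono)
  finally have "enn2real (ennreal (f n powr p)) \<le> enn2real (lq_raw q f)" using assms by (intro enn2real_mono) auto
  then have "(f n powr p) powr (1 / p) \<le> enn2real (lq_raw q f) powr (1 / p)"
    using p by (intro powr_mono2) auto
  then show ?thesis using assms False p by (simp add: lq_norm_def powr_powr p_def)
qed

text \<open>With \<open>max\<close> in place of a sum, the q-th power is at most the sum of the q-th
  powers, so no constant depending on \<open>q\<close> appears.\<close>

lemma lq_raw_le_max_finite:
  assumes "\<And>n. 0 \<le> f n" "\<And>n. f n \<le> max (g n) (h n)" "\<And>n. 0 \<le> g n" "\<And>n. 0 \<le> h n"
    "lq_raw q g < \<infinity>" "lq_raw q h < \<infinity>"
  shows "lq_raw q f < \<infinity>"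
proof -
  have "lq_raw q f \<le> lq_raw q g + lq_raw q h"
  proof (cases "q = \<infinity>")
    case True
    have "ennreal (f n) \<le> lq_raw q g + lq_raw q h" for n
    proof -
      have "f n \<le> g n + h n" using assms(2-4)[of n] by linarith
      then have "ennreal (f n) \<le> ennreal (g n) + ennreal (h n)" using assms
        by (simp add: ennreal_leI flip: ennreal_plus)
      also have "\<dots> \<le> lq_raw q g + lq_raw q h"
        using True by (auto simp: lq_raw_def intro!: add_mono SUP_upper)
      finally show ?thesis .
    qed
    moreover have "lq_raw q f = (SUP n. ennreal (f n))" using True by (simp add: lq_raw_def)
    ultimately show ?thesis by (simp add: SUP_least)
  next
    case False
    have "f n powr enn2real q \<le> g n powr enn2real q + h n powr enn2real q" for n
    proof -
      have "f n powr enn2real q \<le> (max (g n) (h n)) powr enn2real q" using assms by (intro powr_mono2) auto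
      also have "\<dots> \<le> g n powr enn2real q + h n powr enn2real q" by (simp add: max_def)
      finally show ?thesis .
    qed
    then have "lq_raw q f \<le> (\<integral>\<^sup>+n. ennreal (g n powr enn2real q) + ennreal (h n powr enn2real q) \<partial>count_space UNIV)"
      using False by (auto simp: lq_raw_def simp flip: ennreal_plus intro!: nn_integral_mono ennreal_leI)
    then show ?thesis using False by (simp add: lq_raw_def nn_integral_add)
  qed
  then show ?thesis using assms(5,6) by (auto simp: less_top[symmetric] top_unique)
qed

text \<open>Since \<open>s ^ nat \<bar>n\<bar>\<close> is at most 1, its q-th power does not exceed
  it, and every finite \<open>q\<close> reduces to a geometric series.\<close>

lemma lq_raw_geometric_finite:
  assumes "\<And>n. 0 \<le> f n" "\<And>n. f n \<le> M * s ^ nat \<bar>n\<bar>" "0 < s" "s < 1" "1 \<le> q"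
  shows "lq_raw q f < \<infinity>"
proof -
  have M: "0 \<le> M" using assms(1,2)[of 0] by simp
  have s1: "s ^ nat \<bar>n\<bar> \<le> 1" for n using assms by (intro power_le_one) auto
  have "lq_raw q (\<lambda>n. s ^ nat \<bar>n\<bar>) < \<infinity>"
  proof (cases "q = \<infinity>")
    case True
    have "lq_raw q (\<lambda>n. s ^ nat \<bar>n\<bar>) \<le> 1" using True s1 by (auto simp: lq_raw_def intro!: SUP_least)
    then show ?thesis by (auto simp: less_top[symmetric] top_unique)
  next
    case False
    have "(s ^ nat \<bar>n\<bar>) powr enn2real q \<le> s ^ nat \<bar>n\<bar>" for n
      using powr_mono'[of 1 "enn2real q" "s ^ nat \<bar>n\<bar>"] enn2real_ge_1[OF assms(5) False] s1 assms(3) by simp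
    then have "lq_raw q (\<lambda>n. s ^ nat \<bar>n\<bar>) \<le> (\<integral>\<^sup>+n. ennreal (s ^ nat \<bar>n\<bar>) \<partial>count_space UNIV)"
      using False by (auto simp: lq_raw_def intro!: nn_integral_mono ennreal_leI)
    also have "\<dots> \<le> ennreal (2 / (1 - s))" using assms by (intro nn_integral_geometric_int) auto
    finally show ?thesis by (auto simp: less_top[symmetric] top_unique)
  qed
  then have "lq_raw q (\<lambda>n. M * s ^ nat \<bar>n\<bar>) < \<infinity>" using M assms by (intro lq_raw_cmult_finite) auto
  then show ?thesis using lq_raw_mono[of f "\<lambda>n. M * s ^ nat \<bar>n\<bar>" q] assms(1,2) by (auto intro: le_less_trans)
qed

subsection \<open>Slowly varying majorants\<close>

text \<open>
  Replacing a sequence by its slowly varying majorant costs only a constant in every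
  \<open>\<ell>\<^sup>q\<close>, and reduces all convolution estimates to pointwise ones, uniformly in \<open>q\<close>.
\<close>

definition slow_majorant :: "real \<Rightarrow> (int \<Rightarrow> real) \<Rightarrow> int \<Rightarrow> real" where
  "slow_majorant s f n = (SUP j. s ^ nat \<bar>n - j\<bar> * f j)"

locale slow =
  fixes s :: real
  assumes s_pos: "0 < s" and s_lt_1: "s < 1"
begin

lemma power_abs_diff_triangle: "s ^ nat \<bar>n - k\<bar> * s ^ nat \<bar>k - j\<bar> \<le> s ^ nat \<bar>n - j\<bar>"
  unfolding power_add[symmetric] using s_pos s_lt_1 by (intro power_decreasing) auto

lemma bdd_above_slow:
  assumes "\<And>j. 0 \<le> f j" "\<And>j. f j \<le> M"
  shows "bdd_above (range (\<lambda>j. s ^ nat \<bar>n - j\<bar> * f j))"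
proof (rule bdd_aboveI[of _ M])
  fix y assume "y \<in> range (\<lambda>j. s ^ nat \<bar>n - j\<bar> * f j)"
  then obtain j where y: "y = s ^ nat \<bar>n - j\<bar> * f j" by auto
  have "s ^ nat \<bar>n - j\<bar> \<le> 1" using s_pos s_lt_1 by (intro power_le_one) auto
  then have "y \<le> f j" unfolding y using assms(1)[of j] s_pos by (intro mult_left_le_one_le) auto
  then show "y \<le> M" using assms(2)[of j] by linarith
qed

lemma slow_majorant_upper:
  assumes "\<And>j. 0 \<le> f j" "\<And>j. f j \<le> M"
  shows "s ^ nat \<bar>n - j\<bar> * f j \<le> slow_majorant s f n"
  unfolding slow_majorant_def by (rule cSUP_upper[OF _ bdd_above_slow[OF assms]]) auto

lemma slow_majorant_least:
  assumes "\<And>j. s ^ nat \<bar>n - j\<bar> * f j \<le> c"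
  shows "slow_majorant s f n \<le> c"
  unfolding slow_majorant_def by (rule cSUP_least) (auto simp: assms)

lemma slow_majorant_ge:
  assumes "\<And>j. 0 \<le> f j" "\<And>j. f j \<le> M"
  shows "f n \<le> slow_majorant s f n"
  using slow_majorant_upper[OF assms, of n n] by simp

text \<open>The triangle inequality for \<bar>n - j\<bar> moves the extra weight inside the
  supremum.\<close>

lemma slow_majorant_slow:
  assumes "\<And>j. 0 \<le> f j" "\<And>j. f j \<le> M"
  shows "s ^ nat \<bar>n - k\<bar> * slow_majorant s f k \<le> slow_majorant s f n"
proof -
  have "slow_majorant s f k \<le> slow_majorant s f n / s ^ nat \<bar>n - k\<bar>"
  proof (rule slow_majorant_least)
    fix j
    have "s ^ nat \<bar>n - k\<bar> * s ^ nat \<bar>k - j\<bar> * f j \<le> s ^ nat \<bar>n - j\<bar> * f j"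
      using power_abs_diff_triangle assms by (intro mult_right_mono) auto
    also have "\<dots> \<le> slow_majorant s f n" by (rule slow_majorant_upper[OF assms])
    finally show "s ^ nat \<bar>k - j\<bar> * f j \<le> slow_majorant s f n / s ^ nat \<bar>n - k\<bar>"
      using s_pos by (simp add: field_simps)
  qed
  then show ?thesis using s_pos by (simp add: field_simps)
qed

text \<open>A slowly varying \<open>G\<close> is its own majorant, so the perturbation passes
  through without growing. In the application \<open>G\<close> is the majorant of \<open>f\<close>
  itself and \<open>c\<close> is 1/2, so that it can be absorbed.\<close>

lemma slow_majorant_le_add:
  assumes "\<And>j. 0 \<le> h j" "\<And>j. h j \<le> M" "\<And>j. f j \<le> h j + c * G j" "0 \<le> c"
    "\<And>n k. s ^ nat \<bar>n - k\<bar> * G k \<le> G n"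
  shows "slow_majorant s f n \<le> slow_majorant s h n + c * G n"
proof (rule slow_majorant_least)
  fix j
  have "s ^ nat \<bar>n - j\<bar> * f j \<le> s ^ nat \<bar>n - j\<bar> * (h j + c * G j)"
    using assms(3) s_pos by (intro mult_left_mono) auto
  also have "\<dots> = s ^ nat \<bar>n - j\<bar> * h j + c * (s ^ nat \<bar>n - j\<bar> * G j)" by (simp add: algebra_simps)
  also have "\<dots> \<le> slow_majorant s h n + c * G n"
    using assms by (intro add_mono mult_left_mono slow_majorant_upper[of h M])
  finally show "s ^ nat \<bar>n - j\<bar> * f j \<le> slow_majorant s h n + c * G n" .
qed

text \<open>A geometric sequence decaying no faster than \<open>s\<close> already varies slowly:
  bound \<open>s\<close> by \<open>r\<close> and combine the exponents by the triangle
  inequality.\<close>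

lemma slow_majorant_geometric:
  assumes "\<And>j. f j \<le> M * r ^ nat \<bar>j\<bar>" "s \<le> r" "r \<le> 1" "0 \<le> M"
  shows "slow_majorant s f n \<le> M * r ^ nat \<bar>n\<bar>"
proof (rule slow_majorant_least)
  fix j
  have "s ^ nat \<bar>n - j\<bar> * f j \<le> r ^ nat \<bar>n - j\<bar> * (M * r ^ nat \<bar>j\<bar>)"
  proof -
    have "s ^ nat \<bar>n - j\<bar> * f j \<le> s ^ nat \<bar>n - j\<bar> * (M * r ^ nat \<bar>j\<bar>)"
      using assms s_pos by (intro mult_left_mono) auto
    also have "\<dots> \<le> r ^ nat \<bar>n - j\<bar> * (M * r ^ nat \<bar>j\<bar>)"
      using assms s_pos by (intro mult_right_mono power_mono) auto
    finally show ?thesis .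
  qed
  also have "\<dots> = M * r ^ (nat \<bar>n - j\<bar> + nat \<bar>j\<bar>)" by (simp add: power_add)
  also have "\<dots> \<le> M * r ^ nat \<bar>n\<bar>"
    using assms s_pos by (intro mult_left_mono power_decreasing) auto
  finally show "s ^ nat \<bar>n - j\<bar> * f j \<le> M * r ^ nat \<bar>n\<bar>" .
qed

text \<open>For finite \<open>q\<close>, the q-th power of the supremum is at most the convolution
  of the q-th powers with the kernel \<open>s ^ nat \<bar>n - j\<bar>\<close>, whose mass is at most
  \<open>2 / (1 - s)\<close>. This constant is at least 1, so its q-th root does not exceed it and
  the final bound is uniform in \<open>q\<close>.\<close>

lemma lq_slow_majorant:
  assumes "\<And>j. 0 \<le> f j" "\<And>j. f j \<le> M" "1 \<le> q" "lq_raw q f < \<infinity>"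
  shows "lq_raw q (slow_majorant s f) < \<infinity>"
    and "lq_norm q (slow_majorant s f) \<le> 2 / (1 - s) * lq_norm q f"
proof -
  define C where "C = 2 / (1 - s)"
  have C1: "1 \<le> C" using s_pos s_lt_1 by (simp add: C_def)
  have G0: "0 \<le> slow_majorant s f n" for n
    using slow_majorant_ge[of f M n, OF assms(1,2)] assms(1)[of n] by linarith
  have *: "lq_raw q (slow_majorant s f) \<le> ennreal C * lq_raw q f"
  proof (cases "q = \<infinity>")
    case True
    have "ennreal (slow_majorant s f n) \<le> lq_raw q f" for n
    proof -
      have "slow_majorant s f n \<le> lq_norm q f"
      proof (rule slow_majorant_least)
        fix j
        have "s ^ nat \<bar>n - j\<bar> * f j \<le> 1 * f j" using assms(1) s_pos s_lt_1
          by (intro mult_right_mono power_le_one) auto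
        then show "s ^ nat \<bar>n - j\<bar> * f j \<le> lq_norm q f"
          using le_lq_norm[OF assms(1,3,4), of j] by simp
      qed
      then have "ennreal (slow_majorant s f n) \<le> ennreal (lq_norm q f)" by (rule ennreal_leI)
      also have "ennreal (lq_norm q f) = lq_raw q f" using True assms(4) by (simp add: lq_norm_def)
      finally show ?thesis .
    qed
    moreover have "lq_raw q (slow_majorant s f) = (SUP n. ennreal (slow_majorant s f n))"
      using True by (simp add: lq_raw_def)
    ultimately have "lq_raw q (slow_majorant s f) \<le> lq_raw q f" by (simp add: SUP_least)
    also have "\<dots> = ennreal 1 * lq_raw q f" by simp
    also have "\<dots> \<le> ennreal C * lq_raw q f" using C1 by (intro mult_right_mono ennreal_leI) auto
    finally show ?thesis .
  next
    case False
    define p where "p = enn2real q"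
    have p: "1 \<le> p" using enn2real_ge_1[OF assms(3) False] by (simp add: p_def)
    have "ennreal (slow_majorant s f n powr p) \<le> (\<integral>\<^sup>+j. ennreal (s ^ nat \<bar>n - j\<bar>) * ennreal (f j powr p) \<partial>count_space UNIV)" for n
    proof -
      let ?S = "\<integral>\<^sup>+j. ennreal (s ^ nat \<bar>n - j\<bar>) * ennreal (f j powr p) \<partial>count_space UNIV"
      show ?thesis
      \<comment> \<open>The root of \<open>?S\<close> is taken in the reals, where
        \<open>enn2real\<close> would turn infinity into 0; the infinite case is trivial and split
        off.\<close>
      proof (cases "?S = \<infinity>")
        case False
        have "slow_majorant s f n \<le> enn2real ?S powr (1 / p)"
        proof (rule slow_majorant_least)
          fix j
          have sj: "0 < s ^ nat \<bar>n - j\<bar>" "s ^ nat \<bar>n - j\<bar> \<le> 1" using s_pos s_lt_1 by (auto intro: power_le_one)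
          have "(s ^ nat \<bar>n - j\<bar> * f j) powr p \<le> s ^ nat \<bar>n - j\<bar> * f j powr p"
          proof -
            have "(s ^ nat \<bar>n - j\<bar>) powr p \<le> s ^ nat \<bar>n - j\<bar>"
              using powr_mono'[of 1 p "s ^ nat \<bar>n - j\<bar>"] sj p by simp
            then show ?thesis using assms(1)[of j] s_pos by (simp add: powr_mult mult_right_mono)
          qed
          also have "\<dots> = enn2real (\<integral>\<^sup>+k. (ennreal (s ^ nat \<bar>n - k\<bar>) * ennreal (f k powr p)) * indicator {j} k \<partial>count_space UNIV)"
            using sj by (subst nn_integral_indicator_singleton) (auto simp: enn2real_mult)
          also have "\<dots> \<le> enn2real ?S" using False
            by (intro enn2real_mono nn_integral_mono) (auto simp: indicator_def less_top)
          finally have "((s ^ nat \<bar>n - j\<bar> * f j) powr p) powr (1 / p) \<le> enn2real ?S powr (1 / p)"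
            using p by (intro powr_mono2) auto
          then show "s ^ nat \<bar>n - j\<bar> * f j \<le> enn2real ?S powr (1 / p)"
            using p sj assms(1)[of j] by (simp add: powr_powr)
        qed
        then have "slow_majorant s f n powr p \<le> (enn2real ?S powr (1 / p)) powr p"
          using G0 p by (intro powr_mono2) auto
        then have "ennreal (slow_majorant s f n powr p) \<le> ennreal (enn2real ?S)"
          using p by (intro ennreal_leI) (simp add: powr_powr)
        also have "ennreal (enn2real ?S) = ?S" using False by (simp add: less_top)
        finally show ?thesis .
      qed simp
    qed
    then have "lq_raw q (slow_majorant s f) \<le>
        (\<integral>\<^sup>+n. \<integral>\<^sup>+j. ennreal (s ^ nat \<bar>n - j\<bar>) * ennreal (f j powr p) \<partial>count_space UNIV \<partial>count_space UNIV)"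
      using False by (auto simp: lq_raw_def p_def intro!: nn_integral_mono)
    also have "\<dots> = (\<integral>\<^sup>+j. \<integral>\<^sup>+n. ennreal (s ^ nat \<bar>n - j\<bar>) * ennreal (f j powr p) \<partial>count_space UNIV \<partial>count_space UNIV)"
      by (rule nn_integral_count_space_nn_integral) auto
    also have "\<dots> \<le> (\<integral>\<^sup>+j. ennreal C * ennreal (f j powr p) \<partial>count_space UNIV)"
    proof (rule nn_integral_mono)
      fix j
      have "(\<integral>\<^sup>+n. ennreal (s ^ nat \<bar>n - j\<bar>) \<partial>count_space UNIV) = (\<integral>\<^sup>+n. ennreal (s ^ nat \<bar>n\<bar>) \<partial>count_space UNIV)"
        by (rule nn_integral_bij_count_space[of "\<lambda>n. n - j" UNIV UNIV "\<lambda>n. ennreal (s ^ nat \<bar>n\<bar>)"])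
           (auto intro!: bij_betwI[where g = "\<lambda>n. n + j"])
      then have "(\<integral>\<^sup>+n. ennreal (s ^ nat \<bar>n - j\<bar>) \<partial>count_space UNIV) \<le> ennreal C"
        using nn_integral_geometric_int[of s] s_pos s_lt_1 by (simp add: C_def)
      then show "(\<integral>\<^sup>+n. ennreal (s ^ nat \<bar>n - j\<bar>) * ennreal (f j powr p) \<partial>count_space UNIV) \<le> ennreal C * ennreal (f j powr p)"
        by (subst nn_integral_multc) (auto intro: mult_right_mono)
    qed
    also have "\<dots> = ennreal C * lq_raw q f" using False by (simp add: nn_integral_cmult lq_raw_def p_def)
    finally show ?thesis .
  qed
  then show fin: "lq_raw q (slow_majorant s f) < \<infinity>"
    using assms(4) by (metis ennreal_less_top ennreal_mult_less_top infinity_ennreal_def le_less_trans)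
  have le: "enn2real (lq_raw q (slow_majorant s f)) \<le> C * enn2real (lq_raw q f)"
    using enn2real_mono[OF *] assms(4) C1 by (simp add: enn2real_mult ennreal_mult_less_top)
  show "lq_norm q (slow_majorant s f) \<le> 2 / (1 - s) * lq_norm q f"
  proof (cases "q = \<infinity>")
    case True
    then show ?thesis using le by (simp add: lq_norm_def C_def)
  next
    case False
    define p where "p = enn2real q"
    have p: "1 \<le> p" using enn2real_ge_1[OF assms(3) False] by (simp add: p_def)
    have "enn2real (lq_raw q (slow_majorant s f)) powr (1 / p) \<le> (C * enn2real (lq_raw q f)) powr (1 / p)"
      using le p by (intro powr_mono2) auto
    also have "\<dots> = C powr (1 / p) * enn2real (lq_raw q f) powr (1 / p)" using C1 by (simp add: powr_mult)
    also have "\<dots> \<le> C powr 1 * enn2real (lq_raw q f) powr (1 / p)"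
      using C1 p by (intro mult_right_mono powr_mono) auto
    finally show ?thesis using False C1 s_lt_1 by (simp add: lq_norm_def p_def C_def)
  qed
qed

end

section \<open>Interpolation norms as weighted sequence norms\<close>

context normed_couple
begin

lemma interp_raw_le_lq:
  assumes "0 < a" "a < 1" "x \<in> sum_space A0 A1" "1 \<le> q"
  shows "interp_raw A0 n0 A1 n1 a q x \<le> lq_raw q (\<lambda>n. 2 * dyadic_K a x n)"
proof (cases "q = \<infinity>")
  case True
  have "ennreal (t powr (- a) * K t x) \<le> (SUP n. ennreal (2 * dyadic_K a x n))" if "0 < t" for t
    using weighted_K_le_dyadic_K[OF assms(1-3) that] by (intro SUP_upper2) (auto intro: ennreal_leI)
  then show ?thesis using True by (auto simp: interp_raw_def lq_raw_def intro!: SUP_least)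
next
  case False
  then show ?thesis using interp_raw_le_dyadic_K[OF assms False] by (simp add: lq_raw_def)
qed

lemma lq_le_interp_raw:
  assumes "0 < a" "a < 1" "x \<in> sum_space A0 A1" "1 \<le> q"
  shows "lq_raw q (\<lambda>n. dyadic_K a x n / 2) \<le> 2 * interp_raw A0 n0 A1 n1 a q x"
proof (cases "q = \<infinity>")
  case True
  have "ennreal (dyadic_K a x n / 2) \<le> interp_raw A0 n0 A1 n1 a q x" for n
  proof -
    have "dyadic_K a x n / 2 \<le> (2 powr real_of_int n) powr (- a) * K (2 powr real_of_int n) x"
      using dyadic_K_le_weighted_K[OF assms(1-3), of "2 powr real_of_int n"] by simp
    then have "ennreal (dyadic_K a x n / 2) \<le> ennreal ((2 powr real_of_int n) powr (- a) * K (2 powr real_of_int n) x)"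
      by (rule ennreal_leI)
    also have "\<dots> \<le> interp_raw A0 n0 A1 n1 a q x"
      using True by (auto simp: interp_raw_def intro!: SUP_upper2[of "2 powr real_of_int n"])
    finally show ?thesis .
  qed
  then have "lq_raw q (\<lambda>n. dyadic_K a x n / 2) \<le> interp_raw A0 n0 A1 n1 a q x"
    using True by (auto simp: lq_raw_def intro: SUP_least)
  also have "\<dots> \<le> 2 * interp_raw A0 n0 A1 n1 a q x"
    by (metis add_increasing2 le_iff_add mult_2 order_refl zero_le)
  finally show ?thesis .
next
  case False
  have "lq_raw q (\<lambda>n. dyadic_K a x n / 2) = (\<integral>\<^sup>+n. 2 * ennreal ((dyadic_K a x n / 2) powr enn2real q / 2) \<partial>count_space UNIV)"
    using False unfolding lq_raw_def ennreal_numeral[symmetric]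
    by (simp add: ennreal_mult[symmetric] del: ennreal_numeral)
  also have "\<dots> = 2 * (\<integral>\<^sup>+n. ennreal ((dyadic_K a x n / 2) powr enn2real q / 2) \<partial>count_space UNIV)"
    by (rule nn_integral_cmult) auto
  also have "\<dots> \<le> 2 * interp_raw A0 n0 A1 n1 a q x"
    using dyadic_K_le_interp_raw[OF assms False] by (intro mult_left_mono) auto
  finally show ?thesis .
qed

lemma interp_space_iff_lq:
  assumes "0 < a" "a < 1" "1 \<le> q"
  shows "x \<in> interp_space A0 n0 A1 n1 a q \<longleftrightarrow> x \<in> sum_space A0 A1 \<and> lq_raw q (dyadic_K a x) < \<infinity>"
proof (cases "x \<in> sum_space A0 A1")
  case True
  have "interp_raw A0 n0 A1 n1 a q x < \<infinity>" if "lq_raw q (dyadic_K a x) < \<infinity>"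
    using interp_raw_le_lq[OF assms(1,2) True assms(3)] lq_raw_cmult_finite[of 2 "dyadic_K a x" q] that
      dyadic_K_nonneg[OF True] assms(3) by (auto intro: le_less_trans)
  moreover have "lq_raw q (dyadic_K a x) < \<infinity>" if "interp_raw A0 n0 A1 n1 a q x < \<infinity>"
  proof -
    have "2 * interp_raw A0 n0 A1 n1 a q x < \<infinity>" using that by (simp add: ennreal_mult_less_top)
    then have "lq_raw q (\<lambda>n. dyadic_K a x n / 2) < \<infinity>"
      using lq_le_interp_raw[OF assms(1,2) True assms(3)] by (auto intro: le_less_trans)
    then have "lq_raw q (\<lambda>n. 2 * (dyadic_K a x n / 2)) < \<infinity>"
      using dyadic_K_nonneg[OF True] assms(3) by (intro lq_raw_cmult_finite) auto
    then show ?thesis by simp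
  qed
  ultimately show ?thesis using True by (auto simp: interp_space_def)
qed (simp add: interp_space_def)

text \<open>The 4 is a factor 2 from halving the sequence times at most 2 from the factor 2 in
  \<open>lq_le_interp_raw\<close>, which enters through its q-th root when \<open>q\<close> is
  finite.\<close>

lemma
  assumes "0 < a" "a < 1" "1 \<le> q" "x \<in> interp_space A0 n0 A1 n1 a q"
  shows interp_norm_le_lq: "interp_norm A0 n0 A1 n1 a q x \<le> 2 * lq_norm q (dyadic_K a x)"
    and lq_le_interp_norm: "lq_norm q (dyadic_K a x) \<le> 4 * interp_norm A0 n0 A1 n1 a q x"
proof -
  have x: "x \<in> sum_space A0 A1" and fin: "lq_raw q (dyadic_K a x) < \<infinity>" and fin': "interp_raw A0 n0 A1 n1 a q x < \<infinity>"
    using assms interp_space_iff_lq by (auto simp: interp_space_def)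
  have fin2: "lq_raw q (\<lambda>n. 2 * dyadic_K a x n) < \<infinity>"
    using dyadic_K_nonneg[OF x] assms(3) fin by (intro lq_raw_cmult_finite) auto
  have le: "enn2real (interp_raw A0 n0 A1 n1 a q x) \<le> enn2real (lq_raw q (\<lambda>n. 2 * dyadic_K a x n))"
    using interp_raw_le_lq[OF assms(1,2) x assms(3)] fin2 by (intro enn2real_mono) auto
  then have "interp_norm A0 n0 A1 n1 a q x \<le> lq_norm q (\<lambda>n. 2 * dyadic_K a x n)"
    by (auto simp: interp_norm_def lq_norm_def intro!: powr_mono2)
  then show "interp_norm A0 n0 A1 n1 a q x \<le> 2 * lq_norm q (dyadic_K a x)"
    using dyadic_K_nonneg[OF x] assms(3) by (simp add: lq_norm_cmult)
  have "enn2real (lq_raw q (\<lambda>n. dyadic_K a x n / 2)) \<le> enn2real (2 * interp_raw A0 n0 A1 n1 a q x)"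
    using lq_le_interp_raw[OF assms(1,2) x assms(3)] fin' by (intro enn2real_mono) (auto simp: ennreal_mult_less_top)
  then have le': "enn2real (lq_raw q (\<lambda>n. dyadic_K a x n / 2)) \<le> 2 * enn2real (interp_raw A0 n0 A1 n1 a q x)"
    by (simp add: enn2real_mult)
  have "lq_norm q (\<lambda>n. dyadic_K a x n / 2) \<le> 2 * interp_norm A0 n0 A1 n1 a q x"
  proof (cases "q = \<infinity>")
    case True
    then show ?thesis using le' by (simp add: lq_norm_def interp_norm_def)
  next
    case False
    define p where "p = enn2real q"
    have p: "1 \<le> p" using enn2real_ge_1[OF assms(3) False] by (simp add: p_def)
    have "enn2real (lq_raw q (\<lambda>n. dyadic_K a x n / 2)) powr (1 / p) \<le> (2 * enn2real (interp_raw A0 n0 A1 n1 a q x)) powr (1 / p)"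
      using le' p by (intro powr_mono2) auto
    also have "\<dots> = 2 powr (1 / p) * enn2real (interp_raw A0 n0 A1 n1 a q x) powr (1 / p)" by (simp add: powr_mult)
    also have "\<dots> \<le> 2 powr 1 * enn2real (interp_raw A0 n0 A1 n1 a q x) powr (1 / p)"
      using p by (intro mult_right_mono powr_mono) auto
    finally show ?thesis using False by (simp add: lq_norm_def interp_norm_def p_def)
  qed
  then have "2 * lq_norm q (\<lambda>n. dyadic_K a x n / 2) \<le> 4 * interp_norm A0 n0 A1 n1 a q x" by simp
  moreover have "2 * lq_norm q (\<lambda>n. dyadic_K a x n / 2) = lq_norm q (\<lambda>n. 2 * (dyadic_K a x n / 2))"
    using dyadic_K_nonneg[OF x] assms(3) by (intro lq_norm_cmult[symmetric]) auto
  ultimately show "lq_norm q (dyadic_K a x) \<le> 4 * interp_norm A0 n0 A1 n1 a q x" by simp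
qed

text \<open>The weight of exponent \<open>c\<close> lies below that of \<open>a\<close> for
  \<open>n \<ge> 0\<close> and below that of \<open>b\<close> for \<open>n < 0\<close>. This will
  put the given \<open>y\<close> into every space between the two endpoints.\<close>

lemma interp_space_between:
  assumes "0 < a" "a \<le> c" "c \<le> b" "b < 1" "1 \<le> q"
    "x \<in> interp_space A0 n0 A1 n1 a q" "x \<in> interp_space A0 n0 A1 n1 b q"
  shows "x \<in> interp_space A0 n0 A1 n1 c q"
proof -
  have x: "x \<in> sum_space A0 A1" using assms(6) by (simp add: interp_space_def)
  have "dyadic_K c x n \<le> max (dyadic_K a x n) (dyadic_K b x n)" for n
  proof (cases "n \<ge> 0")
    case True
    have "2 powr (- c * real_of_int n) \<le> 2 powr (- a * real_of_int n)"
      using mult_right_mono[OF assms(2), of "real_of_int n"] True by (intro powr_mono) auto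
    then have "dyadic_K c x n \<le> dyadic_K a x n" unfolding dyadic_K_def
      by (rule mult_right_mono) (simp add: K_nonneg x)
    then show ?thesis by (rule max.coboundedI1)
  next
    case False
    have "2 powr (- c * real_of_int n) \<le> 2 powr (- b * real_of_int n)"
      using mult_right_mono_neg[OF assms(3), of "real_of_int n"] False by (intro powr_mono) auto
    then have "dyadic_K c x n \<le> dyadic_K b x n" unfolding dyadic_K_def
      by (rule mult_right_mono) (simp add: K_nonneg x)
    then show ?thesis by (rule max.coboundedI2)
  qed
  moreover have "lq_raw q (dyadic_K a x) < \<infinity>" "lq_raw q (dyadic_K b x) < \<infinity>"
    using assms interp_space_iff_lq[of a q x] interp_space_iff_lq[of b q x] by linarith+
  ultimately have "lq_raw q (dyadic_K c x) < \<infinity>"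
    using dyadic_K_nonneg[OF x] by (intro lq_raw_le_max_finite[of "dyadic_K c x" "dyadic_K a x" "dyadic_K b x"])
  then show ?thesis using assms x interp_space_iff_lq[of c q x] by linarith
qed

end

subsection \<open>Multiplying by a slowly varying scale-dependent factor\<close>

lemma sum_power_le:
  fixes r :: real
  assumes "0 \<le> r" "r < 1"
  shows "(\<Sum>j<N. r ^ j) \<le> 1 / (1 - r)"
  using sum_le_suminf[of "\<lambda>j. r ^ j" "{..<N}"] suminf_geometric[of r] summable_geometric[of r] assms by simp

context normed_couple
begin

text \<open>
  With near-optimal splittings \<open>x = \<alpha>\<^sub>k + \<beta>\<^sub>k\<close> at \<open>t = 2\<^sup>k\<close>, formally \<open>x' = \<Sum>\<^sub>k l\<^bsup>|k|\<^esup> (\<alpha>\<^sub>k\<^sub>+\<^sub>1 - \<alpha>\<^sub>k)\<close>.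
  Summation by parts turns this into
  \<open>x' = x - \<Sum>\<^sub>j (l\<^sup>j - l\<^bsup>j+1\<^esup>) (\<alpha>\<^bsub>-j\<^esub> + \<beta>\<^bsub>j+1\<^esub>)\<close>, where the two parts converge absolutely in
  \<open>A0\<close> and \<open>A1\<close>.
\<close>

lemma ex_approximate_multiplier:
  assumes banach0: "banach_on A0 n0" and banach1: "banach_on A1 n1"
    and x: "x \<in> sum_space A0 A1" and Kpos: "\<And>t. 0 < t \<Longrightarrow> 0 < K t x"
    and l: "0 < l" "l < 1" and s: "0 < s" "s < 1" "2 powr (- a) < s" "2 powr (a - 1) < s"
    and G: "\<And>k. l ^ nat \<bar>k\<bar> * dyadic_K a x k \<le> G k" "\<And>n k. s ^ nat \<bar>n - k\<bar> * G k \<le> G n"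
  obtains x' where "x' \<in> sum_space A0 A1"
    "\<And>n. \<exists>p\<in>A0. \<exists>r\<in>A1. x' - l ^ nat \<bar>n\<bar> *\<^sub>R x = p + r \<and>
       n0 p + 2 powr real_of_int n * n1 r \<le>
         (1 / l - 1) * (4 / (1 - 2 powr (- a) / s) + 4 / (1 - 2 powr (a - 1) / s)) * 2 powr (a * real_of_int n) * G n"
proof -
  \<comment> \<open>Ratios of the geometric series below. One scale down gains
    \<open>2 powr (- a)\<close> for the pieces in \<open>A0\<close>, one scale up gains
    \<open>2 powr (a - 1)\<close> for those in \<open>A1\<close>, and comparing \<open>G\<close> at
    neighbouring scales costs 1/s. The choice of \<open>s\<close> keeps both ratios below 1.\<close>
  define \<tau> where "\<tau> = 2 powr (- a) / s"
  define \<upsilon> where "\<upsilon> = 2 powr (a - 1) / s"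
  define \<delta> where "\<delta> = 1 / l - 1"
  \<comment> \<open>\<open>D n\<close> bounds a piece in \<open>A0\<close> seen from t = 2^n, with
    the 2 coming from splittings that are optimal up to a factor 2. \<open>D1 n\<close> is the
    matching bound in \<open>A1\<close>, where \<open>K\<close> carries the weight 2^n.\<close>
  define D where "D n = 2 * \<delta> * 2 powr (a * real_of_int n) * G n" for n :: int
  define D1 where "D1 n = 2 powr (- real_of_int n) * D n" for n :: int
  \<comment> \<open>The differences \<open>l ^ j - l ^ Suc j\<close> produced by the summation by
    parts.\<close>
  define w where "w j = l ^ j * (1 - l)" for j
  have \<tau>: "0 < \<tau>" "\<tau> < 1" and \<upsilon>: "0 < \<upsilon>" "\<upsilon> < 1" using s by (auto simp: \<tau>_def \<upsilon>_def field_simps)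
  have \<delta>: "0 < \<delta>" using l by (simp add: \<delta>_def field_simps)
  have w0: "0 < w j" for j using l by (simp add: w_def)
  have G0: "0 \<le> G n" for n
  proof -
    have "0 \<le> l ^ nat \<bar>n\<bar> * dyadic_K a x n" using l Kpos[of "2 powr real_of_int n"] by (simp add: dyadic_K_def)
    then show ?thesis using G(1)[of n] by linarith
  qed
  have D0: "0 \<le> D n" "0 \<le> D1 n" for n using \<delta> G0 by (auto simp: D_def D1_def)
  have "\<exists>u v. u \<in> A0 \<and> v \<in> A1 \<and> x = u + v \<and>
      n0 u + 2 powr real_of_int k * n1 v < 2 * K (2 powr real_of_int k) x" for k :: int
    using K_decompose[OF x, of "2 powr real_of_int k" "2 * K (2 powr real_of_int k) x"]
      Kpos[of "2 powr real_of_int k"] by (auto, blast)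
  then obtain al be where ab: "\<And>k. al k \<in> A0" "\<And>k. be k \<in> A1" "\<And>k. x = al k + be k"
      "\<And>k::int. n0 (al k) + 2 powr real_of_int k * n1 (be k) < 2 * K (2 powr real_of_int k) x"
    by metis
  have al0: "0 \<le> n0 (al k)" and be0: "0 \<le> n1 (be k)" for k
    using ab norm_on_nonneg[OF norm0] norm_on_nonneg[OF norm1] by auto
  have K_le_G: "l ^ nat \<bar>k\<bar> * K (2 powr real_of_int k) x \<le> 2 powr (a * real_of_int k) * G k" for k
    using G(1)[of k] by (simp add: dyadic_K_def powr_minus field_simps)
  \<comment> \<open>For \<open>k = int j + 1\<close> this is an equality: the 1/l hidden in
    \<open>\<delta>\<close> compensates the exponent being one larger than \<open>j\<close>.\<close>
  have w_le: "w j \<le> \<delta> * l ^ nat \<bar>k\<bar>" if "k = - int j \<or> k = int j + 1" for j k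
    using that
  proof
    assume k: "k = - int j"
    have "1 - l \<le> \<delta>" using l mult_nonneg_nonneg[of "1 - l" "1 - l"] by (simp add: \<delta>_def field_simps)
    then show ?thesis using l k by (simp add: w_def mult.commute)
  next
    assume "k = int j + 1"
    then have "nat \<bar>k\<bar> = Suc j" by auto
    then show ?thesis using l by (simp add: w_def \<delta>_def field_simps)
  qed
  \<comment> \<open>The disjunction lists the two scales \<open>k\<close> at which the weight
    \<open>w j\<close> occurs. The piece is measured from scale \<open>n\<close>, which lies
    \<open>i\<close> steps above \<open>k\<close>; \<open>bound1\<close> treats scales
    \<open>i\<close> steps below \<open>k\<close> in the same way.\<close>
  have bound0: "n0 (w j *\<^sub>R al k) \<le> D n * \<tau> ^ i"
    if jk: "k = - int j \<or> k = int j + 1" and k: "k = n - int i" for j k n i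
  proof -
    have "n0 (w j *\<^sub>R al k) = w j * n0 (al k)" using norm_on_scaleR[OF norm0 ab(1)] w0[of j] by simp
    also have "\<dots> \<le> (\<delta> * l ^ nat \<bar>k\<bar>) * (2 * K (2 powr real_of_int k) x)"
    proof (rule mult_mono[OF w_le[OF jk]])
      have "0 \<le> 2 powr real_of_int k * n1 (be k)" using be0 by simp
      then show "n0 (al k) \<le> 2 * K (2 powr real_of_int k) x" using ab(4)[of k] by linarith
    qed (use \<delta> l al0 in auto)
    also have "\<dots> = 2 * \<delta> * (l ^ nat \<bar>k\<bar> * K (2 powr real_of_int k) x)" by simp
    also have "\<dots> \<le> 2 * \<delta> * (2 powr (a * real_of_int k) * G k)"
      using K_le_G \<delta> by (intro mult_left_mono) auto
    also have "\<dots> \<le> 2 * \<delta> * (2 powr (a * real_of_int k) * (G n / s ^ i))"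
      using G(2)[of n k] k s \<delta> by (intro mult_left_mono) (auto simp: field_simps)
    also have "2 powr (a * real_of_int k) = 2 powr (a * real_of_int n) * (2 powr (- a)) ^ i"
      by (simp add: k powr_realpow[symmetric] powr_powr powr_add[symmetric] algebra_simps)
    finally show ?thesis by (simp add: D_def \<tau>_def power_divide mult_ac)
  qed
  have bound1: "n1 (w j *\<^sub>R be k) \<le> D1 n * \<upsilon> ^ i"
    if jk: "k = - int j \<or> k = int j + 1" and k: "k = n + int i" for j k n i
  proof -
    have "n1 (w j *\<^sub>R be k) = w j * n1 (be k)" using norm_on_scaleR[OF norm1 ab(2)] w0[of j] by simp
    also have "\<dots> \<le> (\<delta> * l ^ nat \<bar>k\<bar>) * (2 powr (- real_of_int k) * (2 * K (2 powr real_of_int k) x))"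
    proof (rule mult_mono[OF w_le[OF jk]])
      have "2 powr real_of_int k * n1 (be k) \<le> 2 * K (2 powr real_of_int k) x"
        using ab(4)[of k] al0[of k] by linarith
      then show "n1 (be k) \<le> 2 powr (- real_of_int k) * (2 * K (2 powr real_of_int k) x)"
        by (simp add: powr_minus field_simps)
    qed (use \<delta> l be0 in auto)
    also have "\<dots> = 2 * \<delta> * 2 powr (- real_of_int k) * (l ^ nat \<bar>k\<bar> * K (2 powr real_of_int k) x)" by simp
    also have "\<dots> \<le> 2 * \<delta> * 2 powr (- real_of_int k) * (2 powr (a * real_of_int k) * G k)"
      using K_le_G \<delta> by (intro mult_left_mono) auto
    also have "\<dots> \<le> 2 * \<delta> * 2 powr (- real_of_int k) * (2 powr (a * real_of_int k) * (G n / s ^ i))"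
      using G(2)[of n k] k s \<delta> by (intro mult_left_mono) (auto simp: field_simps)
    also have "\<dots> = 2 * \<delta> * (2 powr (- real_of_int k) * 2 powr (a * real_of_int k)) * (G n / s ^ i)" by simp
    also have "2 powr (- real_of_int k) * 2 powr (a * real_of_int k)
        = 2 powr (- real_of_int n) * 2 powr (a * real_of_int n) * (2 powr (a - 1)) ^ i"
      by (simp add: k powr_realpow[symmetric] powr_powr powr_add[symmetric] algebra_simps)
    finally show ?thesis by (simp add: D_def D1_def \<upsilon>_def power_divide mult_ac)
  qed
  have geo: "summable (\<lambda>j. c * \<rho> ^ j)" "suminf (\<lambda>j. c * \<rho> ^ j) = c / (1 - \<rho>)"
    if "0 < \<rho>" "\<rho> < 1" for c \<rho> :: real
    using that by (auto simp: suminf_mult suminf_geometric summable_geometric intro!: summable_mult)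
  have shift: "c * \<rho> ^ (i + j) \<le> c * \<rho> ^ j" if "0 \<le> c" "0 < \<rho>" "\<rho> < 1" for c \<rho> :: real and i j
    using that by (intro mult_left_mono power_decreasing) auto
  have double: "c / (1 - \<rho>) \<le> 2 * c / (1 - \<rho>)" if "0 \<le> c" "\<rho> < 1" for c \<rho> :: real
    using that by (intro divide_right_mono) auto
  define f0 where "f0 j = w j *\<^sub>R al (- int j)" for j
  define f1 where "f1 j = w j *\<^sub>R be (int j + 1)" for j
  have fA: "f0 j \<in> A0" "f1 j \<in> A1" for j
    using ab subspace_scale[OF subspace0] subspace_scale[OF subspace1] by (auto simp: f0_def f1_def)
  have f0_le: "n0 (f0 j) \<le> D n * \<tau> ^ i" if "- int j = n - int i" for j n i
    unfolding f0_def using that by (intro bound0) auto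
  have f1_le: "n1 (f1 j) \<le> D1 n * \<upsilon> ^ i" if "int j + 1 = n + int i" for j n i
    unfolding f1_def using that by (intro bound1) auto
  have sm0: "summable (\<lambda>j. n0 (f0 j))"
    using f0_le[of _ 0] norm_on_nonneg[OF norm0 fA(1)]
    by (intro summable_comparison_test'[OF geo(1)[OF \<tau>, of "D 0"], of 0]) auto
  obtain P where P: "P \<in> A0"
    "\<forall>N v. summable v \<longrightarrow> (\<forall>j. n0 (f0 (N + j)) \<le> v j) \<longrightarrow> n0 (P - (\<Sum>j<N. f0 j)) \<le> suminf v"
    using banach_on_series[OF banach0 fA(1) sm0] by blast
  have sm1: "summable (\<lambda>j. n1 (f1 j))"
    using f1_le[of _ 1] norm_on_nonneg[OF norm1 fA(2)]
    by (intro summable_comparison_test'[OF geo(1)[OF \<upsilon>, of "D1 1"], of 0]) auto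
  obtain Q where Q: "Q \<in> A1"
    "\<forall>N v. summable v \<longrightarrow> (\<forall>j. n1 (f1 (N + j)) \<le> v j) \<longrightarrow> n1 (Q - (\<Sum>j<N. f1 j)) \<le> suminf v"
    using banach_on_series[OF banach1 fA(2) sm1] by blast
  \<comment> \<open>The weights telescope to \<open>1 - l ^ N\<close>, and each summand may split
    \<open>x\<close> at a scale of its own. The freedom in \<open>k\<close> is used to cancel the
    head of either \<open>Q\<close> or \<open>P\<close>.\<close>
  have split: "(1 - l ^ N) *\<^sub>R x = (\<Sum>j<N. w j *\<^sub>R al (k j)) + (\<Sum>j<N. w j *\<^sub>R be (k j))" for N k
  proof -
    have "(\<Sum>j<N. w j) = 1 - l ^ N" by (induction N) (auto simp: w_def algebra_simps)
    moreover have "(\<Sum>j<N. w j *\<^sub>R al (k j)) + (\<Sum>j<N. w j *\<^sub>R be (k j)) = (\<Sum>j<N. w j *\<^sub>R x)"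
      by (simp add: sum.distrib[symmetric] scaleR_add_right[symmetric] ab(3)[symmetric])
    ultimately show ?thesis by (simp add: scaleR_sum_left[symmetric])
  qed
  define x' where "x' = x - P - Q"
  \<comment> \<open>The regrouping leaves components in \<open>A0\<close> only from scales at most
    \<open>n\<close> and components in \<open>A1\<close> only from scales above \<open>n\<close>,
    the directions in which \<open>bound0\<close> and \<open>bound1\<close> decay. At most two
    geometric sums meet on each side, hence the factor 2.\<close>
  have splitting: "\<exists>p\<in>A0. \<exists>r\<in>A1. x' - l ^ nat \<bar>n\<bar> *\<^sub>R x = p + r \<and> n0 p \<le> 2 * D n / (1 - \<tau>) \<and> n1 r \<le> 2 * D1 n / (1 - \<upsilon>)" for n
  proof (cases "n \<ge> 0")
    case True
    then obtain N where n: "n = int N" using nonneg_int_cases by blast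
    define S where "S = (\<Sum>j<N. w j *\<^sub>R al (int j + 1))"
    define R where "R = Q - (\<Sum>j<N. f1 j)"
    have S: "S \<in> A0" unfolding S_def using ab subspace0 by (intro subspace_sum subspace_scale) auto
    have R: "R \<in> A1" unfolding R_def using Q fA subspace1 by (intro subspace_diff subspace_sum) auto
    have "n0 S \<le> (\<Sum>j<N. n0 (w j *\<^sub>R al (int j + 1)))"
      unfolding S_def using ab subspace0 norm0 by (intro norm_on_sum_le subspace_scale) auto
    \<comment> \<open>The scale is \<open>int j + 1\<close>, hence \<open>N - Suc j\<close> steps
      below \<open>n\<close>.\<close>
    also have "\<dots> \<le> (\<Sum>j<N. D n * \<tau> ^ (N - Suc j))" by (intro sum_mono bound0) (auto simp: n)
    also have "\<dots> = D n * (\<Sum>j<N. \<tau> ^ j)"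
      unfolding sum_distrib_left[symmetric] using sum.nat_diff_reindex[of "\<lambda>i. \<tau> ^ i" N] by simp
    also have "\<dots> \<le> D n * (1 / (1 - \<tau>))" using \<tau> D0 by (intro mult_left_mono sum_power_le) auto
    finally have nS: "n0 S \<le> D n / (1 - \<tau>)" by simp
    \<comment> \<open>The terms of \<open>P\<close> sit at scales at most 0, so \<open>N\<close>
      further factors of \<open>\<tau>\<close> are available; they are discarded.\<close>
    have "n0 (f0 (0 + j)) \<le> D n * \<tau> ^ j" for j
      using f0_le[of j n "N + j"] shift[OF D0(1)[of n] \<tau>, of N j] by (simp add: n)
    then have nP: "n0 P \<le> D n / (1 - \<tau>)" using P(2)[rule_format, OF geo(1)[OF \<tau>], of 0 "D n"] geo(2)[OF \<tau>] by simp
    have "n1 (f1 (N + j)) \<le> D1 n * \<upsilon> ^ j" for j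
      using f1_le[of "N + j" n "1 + j"] shift[OF D0(2)[of n] \<upsilon>, of 1 j] by (simp add: n)
    then have nR: "n1 R \<le> D1 n / (1 - \<upsilon>)" unfolding R_def
      using Q(2)[rule_format, OF geo(1)[OF \<upsilon>], of N "D1 n"] geo(2)[OF \<upsilon>] by simp
    have "x' - l ^ nat \<bar>n\<bar> *\<^sub>R x = (1 - l ^ N) *\<^sub>R x - P - Q" by (simp add: x'_def n algebra_simps)
    also have "\<dots> = (S - P) + (- R)"
      unfolding split[of N "\<lambda>j. int j + 1"] by (simp add: S_def R_def f1_def)
    finally have "x' - l ^ nat \<bar>n\<bar> *\<^sub>R x = (S - P) + (- R)" .
    moreover have "S - P \<in> A0" "- R \<in> A1"
      using S P R subspace_diff[OF subspace0] subspace_neg[OF subspace1] by auto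
    moreover have "n0 (S - P) \<le> 2 * D n / (1 - \<tau>)"
      using norm_on_diff_le[OF subspace0 norm0 S P(1)] nS nP by simp
    moreover have "n1 (- R) \<le> 2 * D1 n / (1 - \<upsilon>)"
      using norm_on_minus[OF norm1 R] nR double[OF D0(2)[of n] \<upsilon>(2)] by linarith
    ultimately show ?thesis by blast
  next
    case False
    then obtain N where n: "n = - int N" by (metis int_cases2 nle_le of_nat_0_le_iff)
    \<comment> \<open>Mirror image: splitting at the scales \<open>- int j\<close> cancels the first
      \<open>N\<close> terms of \<open>P\<close> and leaves a finite sum in \<open>A1\<close> beside
      all of \<open>Q\<close>.\<close>
    define S where "S = (\<Sum>j<N. w j *\<^sub>R be (- int j))"
    define R where "R = P - (\<Sum>j<N. f0 j)"
    have S: "S \<in> A1" unfolding S_def using ab subspace1 by (intro subspace_sum subspace_scale) auto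
    have R: "R \<in> A0" unfolding R_def using P fA subspace0 by (intro subspace_diff subspace_sum) auto
    have "n1 S \<le> (\<Sum>j<N. n1 (w j *\<^sub>R be (- int j)))"
      unfolding S_def using ab subspace1 norm1 by (intro norm_on_sum_le subspace_scale) auto
    also have "\<dots> \<le> (\<Sum>j<N. D1 n * \<upsilon> ^ (1 + (N - Suc j)))" by (intro sum_mono bound1) (auto simp: n)
    also have "\<dots> \<le> (\<Sum>j<N. D1 n * \<upsilon> ^ (N - Suc j))" by (intro sum_mono shift D0 \<upsilon>)
    also have "\<dots> = D1 n * (\<Sum>j<N. \<upsilon> ^ j)"
      unfolding sum_distrib_left[symmetric] using sum.nat_diff_reindex[of "\<lambda>i. \<upsilon> ^ i" N] by simp
    also have "\<dots> \<le> D1 n * (1 / (1 - \<upsilon>))" using \<upsilon> D0 by (intro mult_left_mono sum_power_le) auto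
    finally have nS: "n1 S \<le> D1 n / (1 - \<upsilon>)" by simp
    have "n1 (f1 (0 + j)) \<le> D1 n * \<upsilon> ^ j" for j
      using f1_le[of j n "Suc N + j"] shift[OF D0(2)[of n] \<upsilon>, of "Suc N" j] by (simp add: n)
    then have nQ: "n1 Q \<le> D1 n / (1 - \<upsilon>)" using Q(2)[rule_format, OF geo(1)[OF \<upsilon>], of 0 "D1 n"] geo(2)[OF \<upsilon>] by simp
    have "n0 (f0 (N + j)) \<le> D n * \<tau> ^ j" for j
      using f0_le[of "N + j" n j] by (simp add: n)
    then have nR: "n0 R \<le> D n / (1 - \<tau>)" unfolding R_def
      using P(2)[rule_format, OF geo(1)[OF \<tau>], of N "D n"] geo(2)[OF \<tau>] by simp
    have "x' - l ^ nat \<bar>n\<bar> *\<^sub>R x = (1 - l ^ N) *\<^sub>R x - P - Q" by (simp add: x'_def n algebra_simps)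
    also have "\<dots> = (- R) + (S - Q)"
      unfolding split[of N "\<lambda>j. - int j"] by (simp add: S_def R_def f0_def)
    finally have "x' - l ^ nat \<bar>n\<bar> *\<^sub>R x = (- R) + (S - Q)" .
    moreover have "- R \<in> A0" "S - Q \<in> A1"
      using S Q R subspace_diff[OF subspace1] subspace_neg[OF subspace0] by auto
    moreover have "n1 (S - Q) \<le> 2 * D1 n / (1 - \<upsilon>)"
      using norm_on_diff_le[OF subspace1 norm1 S Q(1)] nS nQ by simp
    moreover have "n0 (- R) \<le> 2 * D n / (1 - \<tau>)"
      using norm_on_minus[OF norm0 R] nR double[OF D0(1)[of n] \<tau>(2)] by linarith
    ultimately show ?thesis by blast
  qed
  have "\<exists>p\<in>A0. \<exists>r\<in>A1. x' - l ^ nat \<bar>n\<bar> *\<^sub>R x = p + r \<and>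
       n0 p + 2 powr real_of_int n * n1 r \<le>
         (1 / l - 1) * (4 / (1 - 2 powr (- a) / s) + 4 / (1 - 2 powr (a - 1) / s)) * 2 powr (a * real_of_int n) * G n" for n
  proof -
    obtain p r where pr: "p \<in> A0" "r \<in> A1" "x' - l ^ nat \<bar>n\<bar> *\<^sub>R x = p + r"
      "n0 p \<le> 2 * D n / (1 - \<tau>)" "n1 r \<le> 2 * D1 n / (1 - \<upsilon>)"
      using splitting by blast
    have "n0 p + 2 powr real_of_int n * n1 r \<le> 2 * D n / (1 - \<tau>) + 2 powr real_of_int n * (2 * D1 n / (1 - \<upsilon>))"
      using pr by (intro add_mono mult_left_mono) auto
    also have "2 powr real_of_int n * (2 * D1 n / (1 - \<upsilon>)) = 2 * D n / (1 - \<upsilon>)"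
      by (simp add: D1_def powr_minus)
    also have "2 * D n / (1 - \<tau>) + 2 * D n / (1 - \<upsilon>) = \<delta> * (4 / (1 - \<tau>) + 4 / (1 - \<upsilon>)) * 2 powr (a * real_of_int n) * G n"
      by (simp add: D_def algebra_simps)
    finally show ?thesis using pr unfolding \<tau>_def \<upsilon>_def \<delta>_def by blast
  qed
  moreover have "x' \<in> sum_space A0 A1"
  proof -
    have "(al 0 - P) + (be 0 - Q) \<in> sum_space A0 A1"
      using ab P Q by (intro sum_spaceI subspace_diff subspace0 subspace1)
    moreover have "x' = (al 0 - P) + (be 0 - Q)" using ab(3)[of 0] by (simp add: x'_def)
    ultimately show ?thesis by simp
  qed
  ultimately show ?thesis using that by blast
qed

end

subsection \<open>Injectivity near a point of invertibility\<close>

lemma banach_couple_normed_couple: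
  assumes "banach_couple A0 n0 A1 n1"
  shows "normed_couple A0 A1 n0 n1"
  using assms by unfold_locales (auto simp: banach_couple_def banach_on_def)

lemma interp_norm_nonneg: "0 \<le> interp_norm A0 n0 A1 n1 a q x"
  by (simp add: interp_norm_def)

context normed_couple
begin

lemma dyadic_K_add_le:
  assumes "x \<in> sum_space A0 A1" "y \<in> sum_space A0 A1"
  shows "dyadic_K a (x + y) n \<le> dyadic_K a x n + dyadic_K a y n"
  unfolding dyadic_K_def distrib_left[symmetric] using K_add_le[OF _ assms] by (intro mult_left_mono) auto

lemma dyadic_K_diff_le:
  assumes "x \<in> sum_space A0 A1" "y \<in> sum_space A0 A1"
  shows "dyadic_K a (x - y) n \<le> dyadic_K a x n + dyadic_K a y n"
  unfolding dyadic_K_def distrib_left[symmetric] using K_diff_le[OF _ assms] by (intro mult_left_mono) auto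

lemma dyadic_K_scaleR: "x \<in> sum_space A0 A1 \<Longrightarrow> dyadic_K a (c *\<^sub>R x) n = \<bar>c\<bar> * dyadic_K a x n"
  by (simp add: dyadic_K_def K_scaleR)

lemma dyadic_K_le:
  assumes "p \<in> A0" "r \<in> A1" "n0 p + 2 powr real_of_int n * n1 r \<le> C * 2 powr (a * real_of_int n) * g"
  shows "dyadic_K a (p + r) n \<le> C * g"
proof -
  have "K (2 powr real_of_int n) (p + r) \<le> C * 2 powr (a * real_of_int n) * g"
    using K_le[of "2 powr real_of_int n" p r] assms by simp
  then have "dyadic_K a (p + r) n \<le> 2 powr (- a * real_of_int n) * (C * 2 powr (a * real_of_int n) * g)"
    unfolding dyadic_K_def by (rule mult_left_mono) simp
  also have "\<dots> = C * g" by (simp add: powr_minus field_simps)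
  finally show ?thesis .
qed

lemma dyadic_K_le_interp_norm:
  assumes "0 < a" "a < 1" "1 \<le> q" "x \<in> interp_space A0 n0 A1 n1 a q"
  shows "dyadic_K a x n \<le> 4 * interp_norm A0 n0 A1 n1 a q x"
proof -
  have "x \<in> sum_space A0 A1" "lq_raw q (dyadic_K a x) < \<infinity>"
    using assms interp_space_iff_lq[of a q x] by blast+
  then have "dyadic_K a x n \<le> lq_norm q (dyadic_K a x)" using dyadic_K_nonneg assms(3) by (intro le_lq_norm)
  then show ?thesis using lq_le_interp_norm[OF assms] by linarith
qed

text \<open>Up to a constant depending on \<open>t\<close>, \<open>K t\<close> dominates
  \<open>K 1\<close>, so definiteness at 1 spreads to all positive \<open>t\<close>. Positivity
  makes splittings within a factor 2 of the infimum available.\<close>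

lemma K_pos:
  assumes couple: "\<And>x. x \<in> sum_space A0 A1 \<Longrightarrow> K 1 x = 0 \<Longrightarrow> x = 0"
    and x: "x \<in> sum_space A0 A1" "x \<noteq> 0" and t: "0 < t"
  shows "0 < K t x"
proof (rule ccontr)
  assume "\<not> 0 < K t x"
  then have Kt: "K t x = 0" using K_nonneg[of t x] x t by simp
  have "K 1 x \<le> K (max 1 (1 / t) * t) x" using t x by (intro K_mono) (auto simp: max_def)
  also have "\<dots> \<le> max 1 (1 / t) * K t x" using t x by (intro K_scale_le) auto
  finally show False using Kt K_nonneg[of 1 x] couple x by simp
qed

end

lemma bounded_op_pos_bound:
  assumes "bounded_op T A nA B nB" "\<And>x. x \<in> A \<Longrightarrow> 0 \<le> nA x"
  obtains C where "1 \<le> C" "\<And>x. x \<in> A \<Longrightarrow> nB (T x) \<le> C * nA x"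
proof -
  obtain C where C: "\<And>x. x \<in> A \<Longrightarrow> nB (T x) \<le> C * nA x" using assms(1) by (auto simp: bounded_op_def)
  have "nB (T x) \<le> max 1 C * nA x" if "x \<in> A" for x
    using C[OF that] mult_right_mono[OF max.cobounded2[of C 1] assms(2)[OF that]] by linarith
  then show ?thesis using that[of "max 1 C"] by simp
qed

text \<open>The growth condition is what elements of the sum of the spaces at \<open>a\<close> and
  at a nearby \<open>b\<close> satisfy. All constants are fixed before \<open>x\<close> and
  \<open>M\<close>, so one \<open>\<epsilon>\<close> serves every kernel element and every
  \<open>b\<close> in the neighbourhood.\<close>

lemma kernel_trivial_near_invertible:
  fixes T :: "'a::real_vector \<Rightarrow> 'b::real_vector"
  assumes q: "1 \<le> q"
    and X: "banach_couple X0 m0 X1 m1" and Y: "banach_couple Y0 n0 Y1 n1"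
    and T: "couple_op T X0 m0 X1 m1 Y0 n0 Y1 n1"
    and a: "0 < a" "a < 1"
    and inv: "invertible_op T (interp_space X0 m0 X1 m1 a q) (interp_norm X0 m0 X1 m1 a q)
                              (interp_space Y0 n0 Y1 n1 a q) (interp_norm Y0 n0 Y1 n1 a q)"
  obtains \<epsilon> where "0 < \<epsilon>"
    "\<And>x M. x \<in> sum_space X0 X1 \<Longrightarrow> T x = 0 \<Longrightarrow>
       (\<And>n. normed_couple.dyadic_K X0 X1 m0 m1 a x n \<le> M * 2 powr (\<epsilon> * \<bar>real_of_int n\<bar>)) \<Longrightarrow> x = 0"
proof -
  interpret X: normed_couple X0 X1 m0 m1 by (rule banach_couple_normed_couple[OF X])
  interpret Y: normed_couple Y0 Y1 n0 n1 by (rule banach_couple_normed_couple[OF Y])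
  let ?EX = "interp_space X0 m0 X1 m1 a q" and ?NX = "interp_norm X0 m0 X1 m1 a q"
  let ?EY = "interp_space Y0 n0 Y1 n1 a q" and ?NY = "interp_norm Y0 n0 Y1 n1 a q"
  have Tadd: "T (x + y) = T x + T y" if "x \<in> sum_space X0 X1" "y \<in> sum_space X0 X1" for x y
    using T that by (auto simp: couple_op_def)
  have Tscale: "T (c *\<^sub>R x) = c *\<^sub>R T x" if "x \<in> sum_space X0 X1" for c x
    using T that by (auto simp: couple_op_def)
  have TY: "u \<in> X0 \<Longrightarrow> T u \<in> Y0" "v \<in> X1 \<Longrightarrow> T v \<in> Y1" for u v
    using T by (auto simp: couple_op_def bounded_op_def)
  obtain C0 where C0: "1 \<le> C0" "\<And>u. u \<in> X0 \<Longrightarrow> n0 (T u) \<le> C0 * m0 u"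
    using T norm_on_nonneg[OF X.norm0] by (auto simp: couple_op_def elim!: bounded_op_pos_bound)
  obtain C1 where C1: "1 \<le> C1" "\<And>u. u \<in> X1 \<Longrightarrow> n1 (T u) \<le> C1 * m1 u"
    using T norm_on_nonneg[OF X.norm1] by (auto simp: couple_op_def elim!: bounded_op_pos_bound)
  obtain L where L: "1 \<le> L" "\<And>y. y \<in> ?EY \<Longrightarrow> ?NX (the_inv_into ?EX T y) \<le> L * ?NY y"
    using inv interp_norm_nonneg by (auto simp: invertible_op_def elim!: bounded_op_pos_bound)
  have TE: "T x \<in> ?EY" if "x \<in> ?EX" for x using inv that by (auto simp: invertible_op_def bounded_op_def)
  have lower: "?NX x \<le> L * ?NY (T x)" if "x \<in> ?EX" for x
    using L(2)[OF TE[OF that]] the_inv_into_f_f[of T ?EX x] inv that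
    by (auto simp: invertible_op_def bij_betw_def)
  \<comment> \<open>\<open>s\<close> is the midpoint between \<open>m\<close> and 1, which makes
    both ratios in the multiplier construction smaller than 1.\<close>
  define m :: real where "m = max (2 powr (- a)) (2 powr (a - 1))"
  define s where "s = (1 + m) / 2"
  have "2 powr (- a) < (1::real)" "2 powr (a - 1) < (1::real)"
    using a powr_less_mono[of "- a" 0 "2::real"] powr_less_mono[of "a - 1" 0 "2::real"] by auto
  then have "m < 1" by (simp add: m_def)
  moreover have m: "2 powr (- a) \<le> m" "2 powr (a - 1) \<le> m" by (simp_all add: m_def)
  moreover have "0 < m" using m(1) by (rule less_le_trans[rotated]) simp
  ultimately have s: "0 < s" "s < 1" "2 powr (- a) < s" "2 powr (a - 1) < s"
    by (auto simp: s_def)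
  interpret slow s using s by unfold_locales
  define B where "B = 4 / (1 - 2 powr (- a) / s) + 4 / (1 - 2 powr (a - 1) / s)"
  have B: "0 < B" unfolding B_def using s by (intro add_pos_pos divide_pos_pos) (auto simp: field_simps)
  \<comment> \<open>Collects all losses, so that \<open>\<delta> * Z \<le> 1 / 2\<close> closes the
    argument. The 16 is 2 from \<open>G \<le> 2 * slow_majorant s h\<close>, times 2 and 4 from
    comparing interpolation norms with \<open>lq\<close> norms; the summand \<open>B\<close> also
    gives \<open>\<delta> * B \<le> 1 / 2\<close>.\<close>
  define Z where "Z = 16 * (C0 + C1) * L * B * (2 / (1 - s)) + B + 1"
  have Z: "0 < Z" "B \<le> Z" "16 * (C0 + C1) * L * B * (2 / (1 - s)) \<le> Z"
  proof -
    have "0 \<le> 16 * (C0 + C1) * L * B * (2 / (1 - s))"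
      using C0 C1 L B s by (intro mult_nonneg_nonneg) auto
    then show "0 < Z" "B \<le> Z" "16 * (C0 + C1) * L * B * (2 / (1 - s)) \<le> Z" using B by (auto simp: Z_def)
  qed
  \<comment> \<open>The second entry forces \<open>1 / r ^ 2 - 1 \<le> 1 / (2 * Z)\<close>; the
    first keeps \<open>r\<close> at least \<open>s\<close>, as
    \<open>slow_majorant_geometric\<close> requires.\<close>
  define r where "r = max s (1 / sqrt (1 + 1 / (2 * Z)))"
  have r: "0 < r" "r < 1" "s \<le> r"
    using s Z by (auto simp: r_def field_simps)
  \<comment> \<open>One factor \<open>r\<close> per scale cancels the permitted growth
    \<open>2 powr \<epsilon>\<close>; the other remains as decay and yields finiteness in every
    \<open>lq\<close>.\<close>
  define l where "l = r ^ 2"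
  have l: "0 < l" "l < 1" using r by (auto simp: l_def power_less_one_iff)
  define \<delta> where "\<delta> = 1 / l - 1"
  have \<delta>0: "0 \<le> \<delta>" using l by (simp add: \<delta>_def field_simps)
  have \<delta>Z: "\<delta> * Z \<le> 1 / 2"
  proof -
    have "1 / sqrt (1 + 1 / (2 * Z)) \<le> r" by (simp add: r_def)
    then have "(1 / sqrt (1 + 1 / (2 * Z))) ^ 2 \<le> l" unfolding l_def using Z by (intro power_mono) auto
    then have "1 / (1 + 1 / (2 * Z)) \<le> l" using Z by (simp add: power_divide)
    then have "1 / l \<le> 1 + 1 / (2 * Z)" using l Z by (simp add: field_simps)
    then have "\<delta> \<le> 1 / (2 * Z)" by (simp add: \<delta>_def)
    then show ?thesis using Z by (simp add: field_simps)
  qed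
  define \<epsilon> where "\<epsilon> = - log 2 r"
  have r_powr: "r = 2 powr (- \<epsilon>)" using r by (simp add: \<epsilon>_def)
  have "0 < \<epsilon>" using r by (simp add: \<epsilon>_def)
  moreover have "x = 0" if x: "x \<in> sum_space X0 X1" and Tx: "T x = 0"
    and le: "\<And>n. X.dyadic_K a x n \<le> M * 2 powr (\<epsilon> * \<bar>real_of_int n\<bar>)" for x M
  proof (rule ccontr)
    assume "x \<noteq> 0"
    then have Kpos: "0 < X.K t x" if "0 < t" for t
      using X x that by (intro X.K_pos) (auto simp: banach_couple_def)
    \<comment> \<open>The size that \<open>x'\<close> should have at scale \<open>n\<close>.\<close>
    define g where "g n = l ^ nat \<bar>n\<bar> * X.dyadic_K a x n" for n
    have g0: "0 \<le> g n" for n using X.dyadic_K_nonneg[OF x] l by (simp add: g_def)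
    have g_le: "g n \<le> M * r ^ nat \<bar>n\<bar>" for n
    proof -
      have "r ^ nat \<bar>n\<bar> * 2 powr (\<epsilon> * \<bar>real_of_int n\<bar>) = 1"
        by (simp add: r_powr powr_realpow[symmetric] powr_powr powr_add[symmetric])
      then have "l ^ nat \<bar>n\<bar> * (M * 2 powr (\<epsilon> * \<bar>real_of_int n\<bar>)) = M * r ^ nat \<bar>n\<bar>"
        by (simp add: l_def power2_eq_square power_mult_distrib)
      moreover have "g n \<le> l ^ nat \<bar>n\<bar> * (M * 2 powr (\<epsilon> * \<bar>real_of_int n\<bar>))"
        unfolding g_def using le l by (intro mult_left_mono) auto
      ultimately show ?thesis by linarith
    qed
    have M: "0 \<le> M" using g0[of 0] g_le[of 0] by simp
    have r_pow: "r ^ nat \<bar>n\<bar> \<le> 1" for n using r by (intro power_le_one) auto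
    have g_bdd: "g n \<le> M" for n using g_le[of n] mult_left_le[OF r_pow M, of n] by linarith
    define G where "G = slow_majorant s g"
    have G_ge: "g n \<le> G n" for n unfolding G_def by (rule slow_majorant_ge[OF g0 g_bdd])
    have G0: "0 \<le> G n" for n using g0[of n] G_ge[of n] by linarith
    have G_slow: "s ^ nat \<bar>n - k\<bar> * G k \<le> G n" for n k
      unfolding G_def by (rule slow_majorant_slow[OF g0 g_bdd])
    have G_le: "G n \<le> M * r ^ nat \<bar>n\<bar>" for n
      unfolding G_def using g_le r M by (intro slow_majorant_geometric) auto
    obtain x' where x': "x' \<in> sum_space X0 X1"
      "\<And>n. \<exists>p\<in>X0. \<exists>r\<in>X1. x' - l ^ nat \<bar>n\<bar> *\<^sub>R x = p + r \<and>
         m0 p + 2 powr real_of_int n * m1 r \<le> \<delta> * B * 2 powr (a * real_of_int n) * G n"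
      using X.ex_approximate_multiplier[of x l s a G] X x Kpos l s G_ge G_slow
      unfolding banach_couple_def \<delta>_def B_def g_def by blast
    define h where "h = X.dyadic_K a x'"
    have h0: "0 \<le> h n" for n using X.dyadic_K_nonneg[OF x'(1)] by (simp add: h_def)
    have \<delta>B: "\<delta> * B \<le> 1 / 2" using mult_left_mono[OF Z(2) \<delta>0] \<delta>Z by linarith
    have close: "X.dyadic_K a (x' - l ^ nat \<bar>n\<bar> *\<^sub>R x) n \<le> 1 / 2 * G n"
      and image: "Y.dyadic_K a (T x') n \<le> (C0 + C1) * \<delta> * B * G n" for n
    proof -
      obtain p v where pv: "p \<in> X0" "v \<in> X1" "x' - l ^ nat \<bar>n\<bar> *\<^sub>R x = p + v"
         "m0 p + 2 powr real_of_int n * m1 v \<le> \<delta> * B * 2 powr (a * real_of_int n) * G n"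
        using x'(2)[of n] by blast
      have "X.dyadic_K a (p + v) n \<le> \<delta> * B * G n" by (rule X.dyadic_K_le[OF pv(1,2,4)])
      then show "X.dyadic_K a (x' - l ^ nat \<bar>n\<bar> *\<^sub>R x) n \<le> 1 / 2 * G n"
        using pv(3) mult_right_mono[OF \<delta>B G0[of n]] by simp
      have pv_sum: "p \<in> sum_space X0 X1" "v \<in> sum_space X0 X1"
        using X.sum_spaceI[OF pv(1) subspace_0[OF X.subspace1]] X.sum_spaceI[OF subspace_0[OF X.subspace0] pv(2)] by auto
      have "x' = (p + v) + l ^ nat \<bar>n\<bar> *\<^sub>R x" using pv(3) by (simp add: algebra_simps)
      then have "T x' = T (p + v) + T (l ^ nat \<bar>n\<bar> *\<^sub>R x)"
        using Tadd X.sum_spaceI[OF pv(1,2)] subspace_scale[OF X.subspace_sum_space x] by simp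
      then have Tx': "T x' = T p + T v" using Tx Tscale[OF x] Tadd[OF pv_sum] by simp
      have m: "0 \<le> m0 p" "0 \<le> m1 v" using pv norm_on_nonneg[OF X.norm0] norm_on_nonneg[OF X.norm1] by auto
      have "n0 (T p) \<le> (C0 + C1) * m0 p"
        using C0(2)[OF pv(1)] mult_nonneg_nonneg[OF order_trans[OF zero_le_one C1(1)] m(1)] by (simp add: distrib_right)
      moreover have "n1 (T v) \<le> (C0 + C1) * m1 v"
        using C1(2)[OF pv(2)] mult_nonneg_nonneg[OF order_trans[OF zero_le_one C0(1)] m(2)] by (simp add: distrib_right)
      ultimately have "n0 (T p) + 2 powr real_of_int n * n1 (T v)
          \<le> (C0 + C1) * m0 p + 2 powr real_of_int n * ((C0 + C1) * m1 v)"
        by (intro add_mono mult_left_mono) auto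
      also have "\<dots> = (C0 + C1) * (m0 p + 2 powr real_of_int n * m1 v)" by (simp add: algebra_simps)
      also have "\<dots> \<le> (C0 + C1) * (\<delta> * B * 2 powr (a * real_of_int n) * G n)"
        using pv(4) C0 C1 by (intro mult_left_mono) auto
      finally show "Y.dyadic_K a (T x') n \<le> (C0 + C1) * \<delta> * B * G n"
        unfolding Tx' using TY pv(1,2) by (intro Y.dyadic_K_le) (auto simp: mult_ac)
    qed
    have lx: "l ^ nat \<bar>n\<bar> *\<^sub>R x \<in> sum_space X0 X1" for n
      using subspace_scale[OF X.subspace_sum_space x] .
    have g_eq: "g n = X.dyadic_K a (l ^ nat \<bar>n\<bar> *\<^sub>R x) n" for n
      using X.dyadic_K_scaleR[OF x] l by (simp add: g_def)
    have dx: "x' - l ^ nat \<bar>n\<bar> *\<^sub>R x \<in> sum_space X0 X1" for n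
      using subspace_diff[OF X.subspace_sum_space x'(1) lx] .
    have gh: "g n \<le> h n + 1 / 2 * G n" for n
      using X.dyadic_K_diff_le[OF x'(1) dx, of a n n] close[of n] by (simp add: g_eq h_def)
    have hG: "h n \<le> 2 * G n" for n
      using X.dyadic_K_add_le[OF dx lx, of a n n n] close[of n] G_ge[of n] G0[of n] by (simp add: g_eq h_def)
    have h_le: "h n \<le> 2 * M * r ^ nat \<bar>n\<bar>" for n using hG[of n] G_le[of n] by simp
    have h_bdd: "h n \<le> 2 * M" for n using h_le[of n] mult_left_le[OF r_pow[of n], of "2 * M"] M by linarith
    \<comment> \<open>Taking the majorant of \<open>g n \<le> h n + 1 / 2 * G n\<close> reproduces
      \<open>G\<close> on both sides. Half of it is absorbed, so \<open>x'\<close> controls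
      \<open>G\<close>.\<close>
    have Gh: "G n \<le> 2 * slow_majorant s h n" for n
    proof -
      have "slow_majorant s g n \<le> slow_majorant s h n + 1 / 2 * G n"
        using h0 h_bdd gh G_slow by (intro slow_majorant_le_add[of h "2 * M"]) auto
      then show ?thesis by (simp add: G_def)
    qed
    \<comment> \<open>The remaining decay \<open>r ^ nat \<bar>n\<bar>\<close> puts
      \<open>x'\<close> into the space at \<open>a\<close>, where the lower bound for
      \<open>T\<close> applies.\<close>
    have hfin: "lq_raw q h < \<infinity>" by (rule lq_raw_geometric_finite[OF h0 h_le r(1,2) q])
    have x'E: "x' \<in> ?EX" using X.interp_space_iff_lq[OF a q] x'(1) hfin by (simp add: h_def)
    note sm = lq_slow_majorant[OF h0 h_bdd q hfin]
    have sm0: "0 \<le> slow_majorant s h n" for n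
      using slow_majorant_ge[of h "2 * M" n, OF h0 h_bdd] h0[of n] by linarith
    define c where "c = 2 * ((C0 + C1) * \<delta> * B)"
    have c': "0 \<le> (C0 + C1) * \<delta> * B" using C0 C1 \<delta>0 B by (intro mult_nonneg_nonneg) auto
    then have c0: "0 \<le> c" unfolding c_def by (rule mult_nonneg_nonneg[rotated]) simp
    have Tx'_le: "Y.dyadic_K a (T x') n \<le> c * slow_majorant s h n" for n
    proof -
      have "(C0 + C1) * \<delta> * B * G n \<le> (C0 + C1) * \<delta> * B * (2 * slow_majorant s h n)"
        by (rule mult_left_mono[OF Gh c'])
      then show ?thesis using image[of n] by (simp add: c_def)
    qed
    have Tx'_sum: "T x' \<in> sum_space Y0 Y1" using TE[OF x'E] by (simp add: interp_space_def)
    have "lq_norm q (Y.dyadic_K a (T x')) \<le> lq_norm q (\<lambda>n. c * slow_majorant s h n)"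
      using Y.dyadic_K_nonneg[OF Tx'_sum] Tx'_le lq_raw_cmult_finite[OF c0 sm0 q sm(1)] by (intro lq_norm_mono)
    also have "\<dots> = c * lq_norm q (slow_majorant s h)" by (rule lq_norm_cmult[OF c0 sm0 q])
    also have "\<dots> \<le> c * (2 / (1 - s) * lq_norm q h)" using sm(2) c0 by (rule mult_left_mono)
    also have "\<dots> \<le> c * (2 / (1 - s) * (4 * ?NX x'))"
      unfolding h_def using X.lq_le_interp_norm[OF a q x'E] c0 s by (intro mult_left_mono) auto
    finally have "?NY (T x') \<le> 2 * (c * (2 / (1 - s) * (4 * ?NX x')))"
      using Y.interp_norm_le_lq[OF a q TE[OF x'E]] by linarith
    then have "L * ?NY (T x') \<le> L * (2 * (c * (2 / (1 - s) * (4 * ?NX x'))))"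
      using L by (intro mult_left_mono) auto
    \<comment> \<open>All constants combine into the main summand of \<open>Z\<close>, so the norm
      of \<open>x'\<close> is at most half of itself.\<close>
    also have "\<dots> = \<delta> * (16 * (C0 + C1) * L * B * (2 / (1 - s))) * ?NX x'" by (simp add: c_def)
    also have "\<dots> \<le> \<delta> * Z * ?NX x'"
      using Z(3) \<delta>0 interp_norm_nonneg by (intro mult_right_mono mult_left_mono)
    also have "\<dots> \<le> 1 / 2 * ?NX x'" using \<delta>Z interp_norm_nonneg by (intro mult_right_mono)
    finally have "?NX x' \<le> 0" using lower[OF x'E] by simp
    \<comment> \<open>The vanishing norm is passed back through \<open>h\<close>, its majorant and
      \<open>G\<close> to \<open>g 0\<close>, which is \<open>K\<close> of the original
      \<open>x\<close> at t = 1.\<close>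
    then have h_zero: "h n \<le> 0" for n
      using X.dyadic_K_le_interp_norm[OF a q x'E, of n] by (simp add: h_def)
    have "slow_majorant s h 0 \<le> 0"
      using h_zero s by (intro slow_majorant_least) (auto intro: mult_nonneg_nonpos)
    then have "g 0 \<le> 0" using Gh[of 0] G_ge[of 0] by linarith
    then show False using Kpos[of 1] by (simp add: g_def X.dyadic_K_def)
  qed
  ultimately show ?thesis using that by blast
qed

text \<open>The difference \<open>u - v\<close> lies in the kernel of \<open>T\<close>. Changing the
  weight of \<open>v\<close> from exponent \<open>b\<close> to exponent \<open>a\<close> costs a
  factor \<open>2 powr ((b - a) * real_of_int n)\<close>, which the growth condition
  tolerates.\<close>

lemma preimages_agree_near_invertible:
  fixes T :: "'a::real_vector \<Rightarrow> 'b::real_vector"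
  assumes q: "1 \<le> q"
    and X: "banach_couple X0 m0 X1 m1" and Y: "banach_couple Y0 n0 Y1 n1"
    and T: "couple_op T X0 m0 X1 m1 Y0 n0 Y1 n1"
    and a: "0 < a" "a < 1"
    and inv: "invertible_op T (interp_space X0 m0 X1 m1 a q) (interp_norm X0 m0 X1 m1 a q)
                              (interp_space Y0 n0 Y1 n1 a q) (interp_norm Y0 n0 Y1 n1 a q)"
  obtains \<epsilon> where "0 < \<epsilon>"
    "\<And>b u v. 0 < b \<Longrightarrow> b < 1 \<Longrightarrow> \<bar>b - a\<bar> < \<epsilon> \<Longrightarrow> u \<in> interp_space X0 m0 X1 m1 a q \<Longrightarrow>
       v \<in> interp_space X0 m0 X1 m1 b q \<Longrightarrow> T u = T v \<Longrightarrow> u = v"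
proof -
  interpret X: normed_couple X0 X1 m0 m1 by (rule banach_couple_normed_couple[OF X])
  obtain \<epsilon> where \<epsilon>: "0 < \<epsilon>" and ker: "\<And>x M. x \<in> sum_space X0 X1 \<Longrightarrow> T x = 0 \<Longrightarrow>
       (\<And>n. X.dyadic_K a x n \<le> M * 2 powr (\<epsilon> * \<bar>real_of_int n\<bar>)) \<Longrightarrow> x = 0"
    by (rule kernel_trivial_near_invertible[OF assms]) blast
  have "u = v" if b: "0 < b" "b < 1" "\<bar>b - a\<bar> < \<epsilon>" and u: "u \<in> interp_space X0 m0 X1 m1 a q"
    and v: "v \<in> interp_space X0 m0 X1 m1 b q" and eq: "T u = T v" for b u v
  proof -
    have uv: "u \<in> sum_space X0 X1" "v \<in> sum_space X0 X1" using u v by (auto simp: interp_space_def)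
    have d: "u - v \<in> sum_space X0 X1" using subspace_diff[OF X.subspace_sum_space uv] .
    have "T u = T (u - v) + T v" using T d uv unfolding couple_op_def by (metis diff_add_cancel)
    then have T0: "T (u - v) = 0" using eq by simp
    define M where "M = 4 * interp_norm X0 m0 X1 m1 a q u + 4 * interp_norm X0 m0 X1 m1 b q v"
    have "X.dyadic_K a (u - v) n \<le> M * 2 powr (\<epsilon> * \<bar>real_of_int n\<bar>)" for n
    proof -
      let ?e = "2 powr (\<epsilon> * \<bar>real_of_int n\<bar>)"
      have e1: "1 \<le> ?e" using \<epsilon> by (intro ge_one_powr_ge_zero) auto
      have "X.dyadic_K a u n \<le> 4 * interp_norm X0 m0 X1 m1 a q u" by (rule X.dyadic_K_le_interp_norm[OF a q u])
      also have "\<dots> \<le> 4 * interp_norm X0 m0 X1 m1 a q u * ?e"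
        using mult_left_mono[OF e1, of "4 * interp_norm X0 m0 X1 m1 a q u"] interp_norm_nonneg[of X0 m0 X1 m1 a q u]
        by simp
      finally have 1: "X.dyadic_K a u n \<le> 4 * interp_norm X0 m0 X1 m1 a q u * ?e" .
      have "X.dyadic_K a v n = X.dyadic_K b v n * 2 powr ((b - a) * real_of_int n)"
        by (simp add: X.dyadic_K_def powr_add[symmetric] algebra_simps)
      also have "\<dots> \<le> 4 * interp_norm X0 m0 X1 m1 b q v * ?e"
      proof (rule mult_mono)
        show "X.dyadic_K b v n \<le> 4 * interp_norm X0 m0 X1 m1 b q v" by (rule X.dyadic_K_le_interp_norm[OF b(1,2) q v])
        have "(b - a) * real_of_int n \<le> \<bar>b - a\<bar> * \<bar>real_of_int n\<bar>" by (metis abs_ge_self abs_mult)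
        also have "\<dots> \<le> \<epsilon> * \<bar>real_of_int n\<bar>" using b(3) by (intro mult_right_mono) auto
        finally show "2 powr ((b - a) * real_of_int n) \<le> ?e" by (intro powr_mono) auto
      qed (auto simp: interp_norm_nonneg)
      finally show ?thesis using 1 X.dyadic_K_diff_le[OF uv, of a n] by (simp add: M_def algebra_simps)
    qed
    then have "u - v = 0" by (rule ker[OF d T0])
    then show ?thesis by simp
  qed
  then show ?thesis using that \<epsilon> by blast
qed

section \<open>Gluing the local agreement along the interval\<close>

theorem theorem4p9:
  fixes T :: "'a::real_vector \<Rightarrow> 'b::real_vector"
    and X0 X1 :: "'a set" and m0 m1 :: "'a \<Rightarrow> real"
    and Y0 Y1 :: "'b set" and n0 n1 :: "'b \<Rightarrow> real"
    and q :: ennreal and I :: "real set" and \<theta>0 \<theta>1 :: real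
  assumes "1 \<le> q"
    and "banach_couple X0 m0 X1 m1" and "banach_couple Y0 n0 Y1 n1"
    and "couple_op T X0 m0 X1 m1 Y0 n0 Y1 n1"
    and "I \<in> components {\<theta> \<in> {0<..<1}.
            invertible_op T (interp_space X0 m0 X1 m1 \<theta> q) (interp_norm X0 m0 X1 m1 \<theta> q)
                            (interp_space Y0 n0 Y1 n1 \<theta> q) (interp_norm Y0 n0 Y1 n1 \<theta> q)}"
    and "\<theta>0 \<in> I" and "\<theta>1 \<in> I"
    and "y \<in> interp_space Y0 n0 Y1 n1 \<theta>0 q \<inter> interp_space Y0 n0 Y1 n1 \<theta>1 q"
  shows "the_inv_into (interp_space X0 m0 X1 m1 \<theta>0 q) T y =
         the_inv_into (interp_space X0 m0 X1 m1 \<theta>1 q) T y"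
proof -
  interpret Y: normed_couple Y0 Y1 n0 n1 by (rule banach_couple_normed_couple[OF assms(3)])
  let ?E = "\<lambda>\<theta>. interp_space X0 m0 X1 m1 \<theta> q" and ?F = "\<lambda>\<theta>. interp_space Y0 n0 Y1 n1 \<theta> q"
  let ?f = "\<lambda>\<theta>. the_inv_into (?E \<theta>) T y"
  \<comment> \<open>Components are connected, so the whole segment between the two exponents
    consists of points of invertibility.\<close>
  define J where "J = {min \<theta>0 \<theta>1..max \<theta>0 \<theta>1}"
  have "J \<subseteq> I"
    unfolding J_def using in_components_connected[OF assms(5)] assms(6,7)
    by (intro connected_contains_Icc) (auto simp: min_def max_def)
  then have J: "0 < \<theta>" "\<theta> < 1" "invertible_op T (?E \<theta>) (interp_norm X0 m0 X1 m1 \<theta> q) (?F \<theta>) (interp_norm Y0 n0 Y1 n1 \<theta> q)"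
    if "\<theta> \<in> J" for \<theta>
    using in_components_subset[OF assms(5)] that by auto
  have yF: "y \<in> ?F \<theta>" if "\<theta> \<in> J" for \<theta>
  proof (rule Y.interp_space_between)
    show "0 < min \<theta>0 \<theta>1" "max \<theta>0 \<theta>1 < 1" using J(1,2)[of "min \<theta>0 \<theta>1"] J(1,2)[of "max \<theta>0 \<theta>1"] by (auto simp: J_def)
    show "min \<theta>0 \<theta>1 \<le> \<theta>" "\<theta> \<le> max \<theta>0 \<theta>1" using that by (auto simp: J_def)
    show "y \<in> ?F (min \<theta>0 \<theta>1)" "y \<in> ?F (max \<theta>0 \<theta>1)" using assms(8) by (auto simp: min_def max_def)
  qed (rule assms(1))
  have preimage: "?f \<theta> \<in> ?E \<theta>" "T (?f \<theta>) = y" if "\<theta> \<in> J" for \<theta>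
    using J(3)[OF that] yF[OF that] the_inv_into_into[of T "?E \<theta>" y "?E \<theta>"] f_the_inv_into_f[of T "?E \<theta>" y]
    by (auto simp: invertible_op_def bij_betw_def)
  show ?thesis
  \<comment> \<open>The preimage of the fixed \<open>y\<close>, viewed as a function of the
    exponent, is locally constant on \<open>J\<close>: preimages at nearby exponents have the same
    image and hence coincide.\<close>
  proof (rule connected_local_const[where A = J and f = ?f])
    show "connected J" "\<theta>0 \<in> J" "\<theta>1 \<in> J" by (auto simp: J_def)
    show "\<forall>a\<in>J. eventually (\<lambda>b. ?f a = ?f b) (at a within J)"
    proof
      fix a assume a: "a \<in> J"
      obtain \<epsilon> where \<epsilon>: "0 < \<epsilon>" "\<And>b u v. 0 < b \<Longrightarrow> b < 1 \<Longrightarrow> \<bar>b - a\<bar> < \<epsilon> \<Longrightarrow> u \<in> ?E a \<Longrightarrow>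
         v \<in> ?E b \<Longrightarrow> T u = T v \<Longrightarrow> u = v"
        by (rule preimages_agree_near_invertible[OF assms(1-4) J[OF a]]) blast
      have "?f a = ?f b" if "b \<in> J" "\<bar>b - a\<bar> < \<epsilon>" for b
        using \<epsilon>(2)[of b "?f a" "?f b"] J(1,2)[OF that(1)] that(2) preimage[OF a] preimage[OF that(1)] by simp
      then show "eventually (\<lambda>b. ?f a = ?f b) (at a within J)"
        unfolding eventually_at dist_real_def using \<epsilon>(1) by blast
    qed
  qed
qed

end
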